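(* Each of the following semidefinite programs is simple for almost any cost matrix $C$ (i.e. for all real symmetric $C$ of the appropriate size outside a set of Lebesgue measure zero). (MaxCut) For $X\in\mathbf{S}^n$: minimize $\operatorname{tr}(CX)$ subject to $\operatorname{diag}(X)=1$ (all diagonal entries equal to $1$), $X\succeq0$. (OrthogonalCut) For an integer $S>0$, $d\in\{1,2,3\}$ and $X\in\mathbf{S}^{Sd}$: minimize $\operatorname{tr}(CX)$ subject to $\mathrm{Block}_s(X)=I_d$ for $s=1,\dots,S$, $X\succeq0$, where $\mathrm{Block}_s(X)$ is the $s$-th diagonal $d\times d$ block of $X$. (ProductSDP) For a positive integer $D$, a partition $S_1,\dots,S_m$ of $\{1,\dots,D\}$ into nonempty sets, and $X\in\mathbf{S}^D$: minimize $\operatorname{tr}(CX)$ subject to $\sum_{k\in S_i}X_{kk}=1$ for $i=1,\dots,m$, $X\succeq0$.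
   Context: $\mathbf{S}^n$ is the space of real symmetric $n\times n$ matrices with the trace inner product $\langle X,Y\rangle=\operatorname{tr}(X^\top Y)$. Consider a standard form SDP (P): minimize $\langle C,X\rangle$ subject to $\mathcal{A}X=b$, $X\succeq0$, with variable $X\in\mathbf{S}^n$, where $[\mathcal{A}X]_i=\langle A_i,X\rangle$ for $i=1,\dots,m$ with fixed $A_i\in\mathbf{S}^n$. Its dual (D) is: maximize $\langle b,y\rangle$ subject to $C-\mathcal{A}^*y\succeq0$, with variable $y\in\mathbb{R}^m$, where $\mathcal{A}^*y=\sum_i y_iA_i$. "Solution" means optimal solution. - Strong duality: a primal-dual solution pair exists, and for any solution pair $(X_\star,y_\star)$ of (P) and (D), $\operatorname{tr}(CX_\star)=b^\top y_\star$. - Surjective constraint map: $\mathcal{A}:\mathbf{S}^n\to\mathbb{R}^m$ is surjective, equivalently the matrices $A_i$ are linearly independent. - Strict complementarity: there is a solution pair $(X_\star,y_\star)$ of (P) and (D) with $\operatorname{rank}(X_\star)+\operatorname{rank}(C-\mathcal{A}^*y_\star)=n$. - (P) is simple if it satisfies strong duality, has a surjective constraint map, satisfies strict complementarity, and both (P) and (D) have unique solutions. For OrthogonalCut, each constraint $\mathrm{Block}_s(X)=I_d$ is an identity of symmetric $d\times d$ matrices and counts as $d(d+1)/2$ scalar constraints, so there are $Sd(d+1)/2$ constraints in total. *)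

theory Defs
  imports "HOL-Analysis.Analysis" "HOL-Library.Uprod"
begin

section \<open>The Euclidean space of real symmetric matrices\<close>

typedef 'n symmat = "{M :: real ^ 'n::finite ^ 'n. transpose M = M}"
  morphisms mat_of Abs_symmat
  by (rule exI[of _ 0]) (simp add: transpose_def vec_eq_iff)

lemma transpose_mat_of [simp]: "transpose (mat_of X) = mat_of X"
  using mat_of[of X] by simp

lemma mat_of_commute: "mat_of X $ i $ j = mat_of X $ j $ i"
proof -
  have "mat_of X $ i $ j = transpose (mat_of X) $ i $ j"
    by (simp only: transpose_mat_of)
  then show ?thesis by (simp only: transpose_def vec_lambda_beta)
qed

lemma mat_of_Abs_symmat_lambda:
  assumes "\<And>i j. f i j = f j i"
  shows "mat_of (Abs_symmat (\<chi> i j. f i j)) = (\<chi> i j. f i j)"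
  by (rule Abs_symmat_inverse) (simp add: transpose_def vec_eq_iff assms)

lemma symmat_eq_iff: "X = Y \<longleftrightarrow> (\<forall>i j. mat_of X $ i $ j = mat_of Y $ i $ j)"
  unfolding mat_of_inject[symmetric, of X Y] vec_eq_iff ..

instantiation symmat :: (finite) real_vector
begin

definition "0 = Abs_symmat 0"
definition "X + Y = Abs_symmat (mat_of X + mat_of Y)"
definition "- X = Abs_symmat (- mat_of X)"
definition "X - Y = Abs_symmat (mat_of X - mat_of Y)"
definition "r *\<^sub>R X = Abs_symmat (r *\<^sub>R mat_of X)"

lemma mat_of_zero [simp]: "mat_of 0 = 0"
  unfolding zero_symmat_def
  by (rule Abs_symmat_inverse) (simp add: transpose_def vec_eq_iff)

lemma mat_of_add [simp]: "mat_of (X + Y) = mat_of X + mat_of Y"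
  unfolding plus_symmat_def
  by (rule Abs_symmat_inverse) (simp add: transpose_def vec_eq_iff mat_of_commute)

lemma mat_of_uminus [simp]: "mat_of (- X) = - mat_of X"
  unfolding uminus_symmat_def
  by (rule Abs_symmat_inverse) (simp add: transpose_def vec_eq_iff mat_of_commute)

lemma mat_of_diff [simp]: "mat_of (X - Y) = mat_of X - mat_of Y"
  unfolding minus_symmat_def
  by (rule Abs_symmat_inverse) (simp add: transpose_def vec_eq_iff mat_of_commute)

lemma mat_of_scaleR [simp]: "mat_of (r *\<^sub>R X) = r *\<^sub>R mat_of X"
  unfolding scaleR_symmat_def
  by (rule Abs_symmat_inverse) (simp add: transpose_def vec_eq_iff mat_of_commute)

instance
  by standard (simp_all add: symmat_eq_iff algebra_simps)

end

lemma trace_transpose_mult: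
  fixes A B :: "real ^ 'n::finite ^ 'n"
  shows "trace (transpose A ** B) = A \<bullet> B"
  unfolding trace_def matrix_matrix_mult_def transpose_def inner_vec_def
  by (simp, rule sum.swap)

instantiation symmat :: (finite) real_inner
begin

definition "inner X Y = trace (transpose (mat_of X) ** mat_of Y)"
definition "norm (X :: 'a symmat) = sqrt (inner X X)"
definition "dist X Y = norm (X - Y :: 'a symmat)"
definition "sgn X = (inverse (norm X) *\<^sub>R X :: 'a symmat)"
definition "(uniformity :: ('a symmat \<times> 'a symmat) filter) =
  (INF e\<in>{0<..}. principal {(X, Y). dist X Y < e})"
definition "open (U :: 'a symmat set) \<longleftrightarrow>
  (\<forall>X\<in>U. eventually (\<lambda>(X', Y). X' = X \<longrightarrow> Y \<in> U) uniformity)"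

lemma inner_symmat_eq: "X \<bullet> Y = mat_of X \<bullet> mat_of Y"
  unfolding inner_symmat_def by (rule trace_transpose_mult)

instance
proof
  fix X Y Z :: "'a symmat" and r :: real
  show "X \<bullet> Y = Y \<bullet> X"
    unfolding inner_symmat_eq by (rule inner_commute)
  show "(X + Y) \<bullet> Z = X \<bullet> Z + Y \<bullet> Z" "(r *\<^sub>R X) \<bullet> Y = r * (X \<bullet> Y)" "0 \<le> X \<bullet> X"
    by (simp_all add: inner_symmat_eq inner_add_left)
  show "X \<bullet> X = 0 \<longleftrightarrow> X = 0"
    by (simp add: inner_symmat_eq) (metis mat_of_inject mat_of_zero)
qed (simp_all add: norm_symmat_def dist_symmat_def sgn_symmat_def
      uniformity_symmat_def open_symmat_def)

end

text \<open>
  The orthonormal basis consists of the \<open>E\<^sub>i\<^sub>i\<close> and of \<open>(E\<^sub>i\<^sub>j + E\<^sub>j\<^sub>i) / sqrt 2\<close> for \<open>i \<noteq> j\<close>.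
  With this instance, \<^term>\<open>lebesgue\<close> at type \<open>'n symmat\<close> is Lebesgue measure on the space of
  symmetric matrices, of dimension \<open>n (n + 1) / 2\<close>.
\<close>

definition sym_unit :: "'n::finite \<Rightarrow> 'n \<Rightarrow> 'n symmat" where
  "sym_unit i j = Abs_symmat (\<chi> k l.
     (if i = j then of_bool (k = i \<and> l = i)
      else (of_bool (k = i \<and> l = j) + of_bool (k = j \<and> l = i)) / sqrt 2))"

lemma mat_of_sym_unit:
  "mat_of (sym_unit i j) = (\<chi> k l.
     (if i = j then of_bool (k = i \<and> l = i)
      else (of_bool (k = i \<and> l = j) + of_bool (k = j \<and> l = i)) / sqrt 2))"
  unfolding sym_unit_def
  by (rule mat_of_Abs_symmat_lambda) (simp only: conj_commute add.commute)

lemma sym_unit_commute: "sym_unit i j = sym_unit j i"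
  by (cases "i = j") (simp_all add: sym_unit_def add.commute)

lemma sum_sum_of_bool:
  fixes f :: "'n::finite \<Rightarrow> 'n \<Rightarrow> real"
  shows "(\<Sum>k\<in>UNIV. \<Sum>l\<in>UNIV. f k l * of_bool (k = i \<and> l = j)) = f i j"
proof -
  have "(\<Sum>k\<in>UNIV. \<Sum>l\<in>UNIV. f k l * of_bool (k = i \<and> l = j))
      = (\<Sum>k\<in>UNIV. \<Sum>l\<in>UNIV. if l = j then (if k = i then f k l else 0) else 0)"
    by (intro sum.cong) auto
  then show ?thesis by simp
qed

lemma inner_sym_unit:
  "X \<bullet> sym_unit i j = (if i = j then mat_of X $ i $ i else sqrt 2 * mat_of X $ i $ j)"
proof (cases "i = j")
  case True
  then show ?thesis
    by (simp only: inner_symmat_eq inner_vec_def mat_of_sym_unit vec_lambda_beta inner_real_def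
        simp_thms if_True sum_sum_of_bool[where f = "\<lambda>k l. mat_of X $ k $ l"])
next
  case False
  have "X \<bullet> sym_unit i j = (\<Sum>k\<in>UNIV. \<Sum>l\<in>UNIV.
      (mat_of X $ k $ l / sqrt 2) * of_bool (k = i \<and> l = j)
    + (mat_of X $ k $ l / sqrt 2) * of_bool (k = j \<and> l = i))"
    unfolding inner_symmat_eq inner_vec_def mat_of_sym_unit inner_real_def vec_lambda_beta
    using False by (intro sum.cong refl) auto
  also have "\<dots> = mat_of X $ i $ j / sqrt 2 + mat_of X $ j $ i / sqrt 2"
    unfolding sum.distrib sum_sum_of_bool[where f = "\<lambda>k l. mat_of X $ k $ l / sqrt 2"] ..
  also have "\<dots> = (2 / sqrt 2) * mat_of X $ i $ j"
    unfolding mat_of_commute[of X j i] by simp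
  also have "\<dots> = sqrt 2 * mat_of X $ i $ j"
    by (simp only: real_div_sqrt zero_le_numeral)
  finally show ?thesis using False by simp
qed

instantiation symmat :: (finite) euclidean_space
begin

definition "Basis = {sym_unit i j | i j :: 'a. True}"

instance
proof
  show "(Basis :: 'a symmat set) \<noteq> {}"
    unfolding Basis_symmat_def by blast
  have "finite {sym_unit i j | i j :: 'a. i \<in> UNIV \<and> j \<in> UNIV}"
    by (rule finite_image_set2) (simp_all add: finite_UNIV)
  then show "finite (Basis :: 'a symmat set)"
    unfolding Basis_symmat_def by (simp only: UNIV_I simp_thms)
next
  fix U V :: "'a symmat"
  assume "U \<in> Basis" "V \<in> Basis"
  then obtain i j k l where U: "U = sym_unit i j" and V: "V = sym_unit k l"
    unfolding Basis_symmat_def by blast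
  have "V \<bullet> V = 1"
    unfolding V inner_sym_unit by (cases "k = l") (simp_all add: mat_of_sym_unit)
  show "U \<bullet> V = (if U = V then 1 else 0)"
  proof (cases "(i = k \<and> j = l) \<or> (i = l \<and> j = k)")
    case True
    then have "U = V" using U V sym_unit_commute[of i j] by metis
    with \<open>V \<bullet> V = 1\<close> show ?thesis by simp
  next
    case False
    then have "\<not> (k = i \<and> l = j)" "\<not> (k = j \<and> l = i)" by blast+
    then have "mat_of (sym_unit i j) $ k $ l = 0"
      by (cases "i = j") (simp_all only: mat_of_sym_unit vec_lambda_beta if_True if_False
          simp_thms of_bool_eq add_0 div_0)
    then have "U \<bullet> V = 0"
      unfolding U V inner_sym_unit by (cases "k = l") simp_all
    with \<open>V \<bullet> V = 1\<close> have "U \<noteq> V" by (metis zero_neq_one)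
    with \<open>U \<bullet> V = 0\<close> show ?thesis by simp
  qed
next
  fix X :: "'a symmat"
  show "(\<forall>U\<in>Basis. X \<bullet> U = 0) \<longleftrightarrow> X = 0"
  proof
    assume *: "\<forall>U\<in>Basis. X \<bullet> U = 0"
    have "mat_of X $ i $ j = 0" for i j
    proof -
      have "X \<bullet> sym_unit i j = 0"
        using * unfolding Basis_symmat_def by blast
      then show ?thesis by (cases "i = j") (simp_all add: inner_sym_unit)
    qed
    then show "X = 0" by (simp add: symmat_eq_iff)
  qed simp
qed

end


section \<open>Semidefinite programs in standard form\<close>

definition psd :: "'n::finite symmat \<Rightarrow> bool" where
  "psd X \<longleftrightarrow> (\<forall>v. 0 \<le> v \<bullet> (mat_of X *v v))"

definition constraint_map :: "('m::finite \<Rightarrow> 'n::finite symmat) \<Rightarrow> 'n symmat \<Rightarrow> real ^ 'm" where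
  "constraint_map A X = (\<chi> i. A i \<bullet> X)"

definition constraint_adjoint :: "('m::finite \<Rightarrow> 'n::finite symmat) \<Rightarrow> real ^ 'm \<Rightarrow> 'n symmat" where
  "constraint_adjoint A y = (\<Sum>i\<in>UNIV. y $ i *\<^sub>R A i)"

definition primal_feasible ::
  "('m::finite \<Rightarrow> 'n::finite symmat) \<Rightarrow> real ^ 'm \<Rightarrow> 'n symmat \<Rightarrow> bool" where
  "primal_feasible A b X \<longleftrightarrow> constraint_map A X = b \<and> psd X"

definition dual_feasible ::
  "('m::finite \<Rightarrow> 'n::finite symmat) \<Rightarrow> 'n symmat \<Rightarrow> real ^ 'm \<Rightarrow> bool" where
  "dual_feasible A C y \<longleftrightarrow> psd (C - constraint_adjoint A y)"

definition primal_solution ::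
  "('m::finite \<Rightarrow> 'n::finite symmat) \<Rightarrow> real ^ 'm \<Rightarrow> 'n symmat \<Rightarrow> 'n symmat \<Rightarrow> bool" where
  "primal_solution A b C = is_arg_min (\<lambda>X. C \<bullet> X) (primal_feasible A b)"

definition dual_solution ::
  "('m::finite \<Rightarrow> 'n::finite symmat) \<Rightarrow> real ^ 'm \<Rightarrow> 'n symmat \<Rightarrow> real ^ 'm \<Rightarrow> bool" where
  "dual_solution A b C = is_arg_max (\<lambda>y. b \<bullet> y) (dual_feasible A C)"

definition strong_duality ::
  "('m::finite \<Rightarrow> 'n::finite symmat) \<Rightarrow> real ^ 'm \<Rightarrow> 'n symmat \<Rightarrow> bool" where
  "strong_duality A b C \<longleftrightarrow>
     (\<exists>X y. primal_solution A b C X \<and> dual_solution A b C y) \<and>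
     (\<forall>X y. primal_solution A b C X \<and> dual_solution A b C y
        \<longrightarrow> trace (mat_of C ** mat_of X) = b \<bullet> y)"

definition strict_complementarity ::
  "('m::finite \<Rightarrow> 'n::finite symmat) \<Rightarrow> real ^ 'm \<Rightarrow> 'n symmat \<Rightarrow> bool" where
  "strict_complementarity A b C \<longleftrightarrow>
     (\<exists>X y. primal_solution A b C X \<and> dual_solution A b C y \<and>
        rank (mat_of X) + rank (mat_of (C - constraint_adjoint A y)) = CARD('n))"

definition simple_sdp ::
  "('m::finite \<Rightarrow> 'n::finite symmat) \<Rightarrow> real ^ 'm \<Rightarrow> 'n symmat \<Rightarrow> bool" where
  "simple_sdp A b C \<longleftrightarrow>
     strong_duality A b C \<and>
     surj (constraint_map A) \<and>
     strict_complementarity A b C \<and>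
     (\<exists>!X. primal_solution A b C X) \<and>
     (\<exists>!y. dual_solution A b C y)"

lemma objective_eq_trace: "C \<bullet> X = trace (mat_of C ** mat_of X)"
  by (simp add: inner_symmat_def)


section \<open>MaxCut\<close>

definition maxcut_A :: "'n::finite \<Rightarrow> 'n symmat" where
  "maxcut_A i = Abs_symmat (\<chi> k l. of_bool (k = i \<and> l = i))"

definition maxcut_b :: "real ^ 'n::finite" where
  "maxcut_b = (\<chi> i. 1)"

lemma mat_of_maxcut_A: "mat_of (maxcut_A i) = (\<chi> k l. of_bool (k = i \<and> l = i))"
  unfolding maxcut_A_def by (rule mat_of_Abs_symmat_lambda) auto

lemma inner_maxcut_A: "maxcut_A i \<bullet> X = mat_of X $ i $ i"
  by (subst inner_commute)
    (simp only: inner_symmat_eq inner_vec_def mat_of_maxcut_A vec_lambda_beta inner_real_def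
      sum_sum_of_bool[where f = "\<lambda>k l. mat_of X $ k $ l"])

lemma primal_feasible_maxcut_iff:
  "primal_feasible maxcut_A maxcut_b X \<longleftrightarrow> (\<forall>i. mat_of X $ i $ i = 1) \<and> psd X"
  by (simp add: primal_feasible_def constraint_map_def maxcut_b_def inner_maxcut_A vec_eq_iff)


section \<open>OrthogonalCut\<close>

text \<open>
  The \<open>S * d\<close> rows and columns are indexed by pairs of a block \<open>s\<close> and a position within the
  block.  The scalar constraints are indexed by a block \<open>s\<close> and an unordered pair \<open>{i, j}\<close> of
  positions (possibly \<open>i = j\<close>), which gives \<open>S * (d * (d + 1) div 2)\<close> of them; the one for
  \<open>{i, j}\<close> fixes the \<open>(i, j)\<close> entry of block \<open>s\<close>.  The divisor \<^term>\<open>card (set_uprod p)\<close> is 1 on the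
  diagonal and 2 off it, where the entry occurs twice in the trace inner product.
\<close>

instance uprod :: (finite) finite
  by standard simp

definition Block :: "'s \<Rightarrow> ('s::finite \<times> 'd::finite) symmat \<Rightarrow> real ^ 'd ^ 'd" where
  "Block s X = (\<chi> i j. mat_of X $ (s, i) $ (s, j))"

definition orthcut_A :: "'s::finite \<times> 'd::finite uprod \<Rightarrow> ('s \<times> 'd) symmat" where
  "orthcut_A = (\<lambda>(s, p). Abs_symmat (\<chi> k l.
     of_bool (fst k = s \<and> fst l = s \<and> Upair (snd k) (snd l) = p) / real (card (set_uprod p))))"

definition orthcut_b :: "real ^ ('s::finite \<times> 'd::finite uprod)" where
  "orthcut_b = (\<chi> q. of_bool (\<not> proper_uprod (snd q)))"

lemma card_orthcut_constraints:
  "CARD('s::finite \<times> 'd::finite uprod) = CARD('s) * (CARD('d) * (CARD('d) + 1) div 2)"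
  by (simp add: card_UNIV_uprod)

lemma mat_of_orthcut_A:
  fixes s :: "'s::finite" and p :: "'d::finite uprod"
  shows "mat_of (orthcut_A (s, p)) = (\<chi> k l.
     of_bool (fst k = s \<and> fst l = s \<and> Upair (snd k) (snd l) = p) / real (card (set_uprod p)))"
  unfolding orthcut_A_def prod.case
proof (rule mat_of_Abs_symmat_lambda)
  fix k l :: "'s \<times> 'd"
  have "Upair (snd k) (snd l) = Upair (snd l) (snd k)" by simp
  then have "(fst k = s \<and> fst l = s \<and> Upair (snd k) (snd l) = p) \<longleftrightarrow>
      (fst l = s \<and> fst k = s \<and> Upair (snd l) (snd k) = p)" by argo
  then show "of_bool (fst k = s \<and> fst l = s \<and> Upair (snd k) (snd l) = p)
        / real (card (set_uprod p))
      = of_bool (fst l = s \<and> fst k = s \<and> Upair (snd l) (snd k) = p)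
        / real (card (set_uprod p))" by (simp only:)
qed

lemma inner_orthcut_A: "orthcut_A (s, Upair i j) \<bullet> X = Block s X $ i $ j"
proof (cases "i = j")
  case True
  have "X \<bullet> orthcut_A (s, Upair i j) = (\<Sum>k\<in>UNIV. \<Sum>l\<in>UNIV.
      mat_of X $ k $ l * of_bool (k = (s, i) \<and> l = (s, i)))"
    unfolding inner_symmat_eq inner_vec_def mat_of_orthcut_A inner_real_def vec_lambda_beta using True
    by (intro sum.cong refl arg_cong2[where f = "(*)"]) (auto simp: prod_eq_iff)
  also have "\<dots> = mat_of X $ (s, i) $ (s, i)"
    by (rule sum_sum_of_bool)
  finally show ?thesis using True by (simp add: Block_def inner_commute)
next
  case False
  have "X \<bullet> orthcut_A (s, Upair i j) = (\<Sum>k\<in>UNIV. \<Sum>l\<in>UNIV.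
      (mat_of X $ k $ l / 2) * of_bool (k = (s, i) \<and> l = (s, j))
    + (mat_of X $ k $ l / 2) * of_bool (k = (s, j) \<and> l = (s, i)))"
    unfolding inner_symmat_eq inner_vec_def mat_of_orthcut_A inner_real_def vec_lambda_beta using False
    by (intro sum.cong refl) (auto simp: prod_eq_iff)
  also have "\<dots> = mat_of X $ (s, i) $ (s, j) / 2 + mat_of X $ (s, j) $ (s, i) / 2"
    unfolding sum.distrib sum_sum_of_bool[where f = "\<lambda>k l. mat_of X $ k $ l / 2"] ..
  also have "\<dots> = mat_of X $ (s, i) $ (s, j)"
    by (simp add: mat_of_commute[of X "(s, j)" "(s, i)"])
  finally show ?thesis by (simp add: Block_def inner_commute)
qed

lemma primal_feasible_orthcut_iff:
  fixes X :: "('s::finite \<times> 'd::finite) symmat"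
  shows "primal_feasible orthcut_A orthcut_b X \<longleftrightarrow> (\<forall>s. Block s X = mat 1) \<and> psd X"
proof -
  have "constraint_map orthcut_A X = orthcut_b \<longleftrightarrow>
      (\<forall>s p. orthcut_A (s, p) \<bullet> X = of_bool (\<not> proper_uprod p))"
    by (auto simp: constraint_map_def orthcut_b_def vec_eq_iff)
  also have "\<dots> \<longleftrightarrow> (\<forall>s i j. orthcut_A (s, Upair i j) \<bullet> X = of_bool (i = j))"
  proof (intro iffI allI)
    fix s :: 's and p :: "'d uprod"
    assume *: "\<forall>s i j. orthcut_A (s, Upair i j) \<bullet> X = of_bool (i = j)"
    obtain i j where "p = Upair i j" by (cases p)
    with * show "orthcut_A (s, p) \<bullet> X = of_bool (\<not> proper_uprod p)" by simp
  qed simp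
  also have "\<dots> \<longleftrightarrow> (\<forall>s. Block s X = mat 1)"
    by (simp add: inner_orthcut_A vec_eq_iff mat_def of_bool_def)
  finally show ?thesis by (simp add: primal_feasible_def)
qed


section \<open>ProductSDP\<close>

definition product_A :: "('m::finite \<Rightarrow> 'n::finite set) \<Rightarrow> 'm \<Rightarrow> 'n symmat" where
  "product_A P i = Abs_symmat (\<chi> k l. of_bool (k = l \<and> k \<in> P i))"

definition product_b :: "real ^ 'm::finite" where
  "product_b = (\<chi> i. 1)"

lemma mat_of_product_A: "mat_of (product_A P i) = (\<chi> k l. of_bool (k = l \<and> k \<in> P i))"
  unfolding product_A_def by (rule mat_of_Abs_symmat_lambda) auto

lemma inner_product_A: "product_A P i \<bullet> X = (\<Sum>k\<in>P i. mat_of X $ k $ k)"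
proof -
  have "product_A P i \<bullet> X = (\<Sum>k\<in>UNIV. \<Sum>l\<in>UNIV.
      if l = k then (if k \<in> P i then mat_of X $ k $ k else 0) else 0)"
    unfolding inner_symmat_eq inner_vec_def mat_of_product_A
    by (auto intro!: sum.cong)
  then show ?thesis by (simp add: sum.If_cases)
qed

lemma primal_feasible_product_iff:
  "primal_feasible (product_A P) product_b X \<longleftrightarrow>
     (\<forall>i. (\<Sum>k\<in>P i. mat_of X $ k $ k) = 1) \<and> psd X"
  by (simp add: primal_feasible_def constraint_map_def product_b_def inner_product_A vec_eq_iff)

end

theory Submission
  imports Defs
begin

text \<open>
  By compactness of the feasible set and Slater's condition, every cost matrix \<open>C\<close> admits an
  optimal pair \<open>(X, y)\<close>, and with \<open>Z = C - A\<^sup>* y\<close> the feasible pairs without duality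
  gap are those with \<open>Z X = 0\<close>.  Call \<open>C\<close> degenerate if some such pair has \<open>rank X + rank Z < n\<close>.
  If \<open>C\<close> is not degenerate, then strict complementarity holds, and so does uniqueness of the
  primal solution: otherwise, following a line inside the primal solution set until it leaves the
  cone would yield a solution of smaller rank, hence a degenerate pair
  (\<open>nonunique_imp_degenerate\<close>).  The dual solution is unique for every \<open>C\<close>, because in each of
  the three problems \<open>(A\<^sup>* u) X = 0\<close> with \<open>X\<close> feasible forces \<open>u = 0\<close>.  All of this is
  \<open>simple_sdp_if_not_degenerate\<close>; it remains to see that degenerate costs form a null set.

  Let the right-hand side \<open>b\<close> vary along with \<open>C\<close>.  Optimal pairs are parametrized by
  \<open>(y, M)\<close> with \<open>M = X - Z\<close>: here \<open>X\<close> is the projection \<open>p M\<close> of \<open>M\<close> to the semidefinite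
  cone, \<open>b = A (p M)\<close> and \<open>C = A\<^sup>* y + p M - M\<close>.  This is a Lipschitz map between spaces of
  the same dimension, and a degenerate pair corresponds to a singular \<open>M\<close>.  Singular matrices
  form a null set, so the degenerate \<open>(b, C)\<close> do as well, and by Fubini's theorem the degenerate
  costs are a null set for almost every \<open>b\<close> (\<open>AE_negligible_degenerate_costs\<close>).

  Finally, in each problem all right-hand sides near the given one are equivalent to it under a
  congruence \<open>X \<mapsto> D X D\<^sup>T\<close> that preserves the range of \<open>A\<^sup>*\<close>: scaling by a diagonal matrix
  for ProductSDP and its special case MaxCut, a block diagonal matrix for OrthogonalCut.  The
  congruence acts on costs by a linear isomorphism and preserves degeneracy, so one good \<open>b\<close> in
  that neighbourhood suffices (\<open>negligible_degenerate_costs\<close>).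
\<close>

section \<open>The cone of positive semidefinite matrices\<close>

lemma inner_matrix_vector_left:
  fixes X :: "'n::finite symmat"
  shows "(mat_of X *v v) \<bullet> w = v \<bullet> (mat_of X *v w)"
  by (metis dot_lmul_matrix transpose_mat_of vector_transpose_matrix)

lemma matrix_vector_axis_nth: "(mat_of X *v axis i 1) $ j = mat_of X $ j $ i"
  by (simp add: matrix_vector_mul_component inner_axis)

lemma linear_matrix_vector_symmat: "linear (\<lambda>X. mat_of X *v v)"
  by (rule linearI) (simp_all add: matrix_vector_mult_add_rdistrib scaleR_matrix_vector_assoc)

text \<open>The rank-one matrix \<open>v v\<^sup>T\<close>.\<close>

definition outer :: "real ^ 'n::finite \<Rightarrow> 'n symmat" where
  "outer v = Abs_symmat (\<chi> i j. v $ i * v $ j)"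

lemma mat_of_outer: "mat_of (outer v) = (\<chi> i j. v $ i * v $ j)"
  unfolding outer_def by (rule mat_of_Abs_symmat_lambda) (simp add: mult.commute)

lemma outer_matrix_vector: "mat_of (outer v) *v w = (v \<bullet> w) *\<^sub>R v"
  by (simp add: vec_eq_iff mat_of_outer matrix_vector_mult_def inner_vec_def
      sum_distrib_left sum_distrib_right mult_ac)

lemma inner_outer: "X \<bullet> outer v = v \<bullet> (mat_of X *v v)"
  by (simp add: inner_symmat_eq inner_vec_def mat_of_outer matrix_vector_mult_def
      sum_distrib_left mult_ac)

lemma outer_scale: "outer (c *\<^sub>R v) = (c * c) *\<^sub>R outer v"
  by (simp add: symmat_eq_iff mat_of_outer mult_ac)

lemma outer_zero [simp]: "outer 0 = 0"
  by (simp add: symmat_eq_iff mat_of_outer)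

lemma norm_outer: "norm (outer v) = v \<bullet> v"
proof -
  have "outer v \<bullet> outer v = (v \<bullet> v)\<^sup>2"
    by (simp add: inner_outer outer_matrix_vector power2_eq_square)
  then show ?thesis by (simp add: norm_eq_sqrt_inner)
qed

lemma psd_iff_outer: "psd X \<longleftrightarrow> (\<forall>v. 0 \<le> X \<bullet> outer v)"
  by (simp add: psd_def inner_outer)

lemma psd_outer: "psd (outer v)"
  by (simp add: psd_iff_outer inner_outer outer_matrix_vector inner_commute)

lemma psd_zero: "psd 0"
  and psd_add: "psd X \<Longrightarrow> psd Y \<Longrightarrow> psd (X + Y)"
  and psd_scaleR: "0 \<le> c \<Longrightarrow> psd X \<Longrightarrow> psd (c *\<^sub>R X)"
  by (simp_all add: psd_iff_outer inner_add_left)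

lemma psd_Collect: "{X :: 'n::finite symmat. psd X} = (\<Inter>v. {X. 0 \<le> outer v \<bullet> X})"
  by (auto simp: psd_iff_outer inner_commute)

lemma closed_psd: "closed {X :: 'n::finite symmat. psd X}"
  unfolding psd_Collect by (intro closed_INT ballI closed_Collect_le continuous_intros)

lemma convex_psd: "convex {X :: 'n::finite symmat. psd X}"
proof -
  have "convex {X. 0 \<le> outer v \<bullet> X}" for v :: "real ^ 'n"
    using convex_halfspace_ge[where a = "outer v" and b = 0] by (simp add: inner_commute)
  then show ?thesis unfolding psd_Collect by (intro convex_INT)
qed

lemma psd_kernel:
  assumes X: "psd X" and v: "v \<bullet> (mat_of X *v v) = 0"
  shows "mat_of X *v v = 0"
proof (rule ccontr)
  define w where "w = mat_of X *v v"
  define a where "a = w \<bullet> w"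
  define c where "c = w \<bullet> (mat_of X *v w)"
  assume "mat_of X *v v \<noteq> 0"
  then have a: "a > 0" by (simp add: a_def w_def)
  have c: "c \<ge> 0" using X by (simp add: psd_def c_def)
  have *: "0 \<le> 2 * t * a + t * t * c" for t
  proof -
    have "0 \<le> (v + t *\<^sub>R w) \<bullet> (mat_of X *v (v + t *\<^sub>R w))"
      using X by (simp add: psd_def)
    also have "\<dots> = v \<bullet> w + t * (v \<bullet> (mat_of X *v w)) + t * (w \<bullet> w) + t * (t * c)"
      by (simp add: matrix_vector_right_distrib matrix_vector_mult_scaleR inner_add_left
          inner_add_right w_def c_def distrib_left)
    also have "v \<bullet> (mat_of X *v w) = w \<bullet> w"
      by (simp add: w_def flip: inner_matrix_vector_left)
    also have "v \<bullet> w = 0" using v by (simp add: w_def)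
    finally show ?thesis by (simp add: a_def)
  qed
  \<comment> \<open>Any negative \<open>t\<close> with \<open>\<bar>t\<bar> c < 2 a\<close> gives a contradiction.\<close>
  define t where "t = - a / (c + 1)"
  have t: "t < 0" "t * (c + 1) = - a" using a c by (simp_all add: t_def divide_neg_pos)
  have "0 \<le> t * (2 * a + t * c)" using *[of t] by (simp add: algebra_simps)
  then have "2 * a + t * c \<le> 0" using t(1) by (simp add: zero_le_mult_iff)
  moreover have "t * c = - a - t" using t(2) by (simp add: algebra_simps)
  ultimately show False using a t(1) by simp
qed

text \<open>
  One step of Cholesky's algorithm: subtracting the rank-one matrix built from column \<open>k\<close>
  clears row and column \<open>k\<close> and stays in the cone.
\<close>

lemma psd_pivot:
  fixes X :: "'n::finite symmat"
  assumes X: "psd X" and k: "mat_of X $ k $ k > 0"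
  shows "psd (X - outer ((1 / sqrt (mat_of X $ k $ k)) *\<^sub>R (mat_of X *v axis k 1)))"
  unfolding psd_iff_outer
proof
  fix v :: "real ^ 'n"
  define x where "x = mat_of X $ k $ k"
  define e :: "real ^ 'n" where "e = axis k 1"
  define s where "s = v \<bullet> (mat_of X *v e)"
  have s': "(mat_of X *v e) \<bullet> v = s" by (simp add: s_def inner_commute)
  have xe: "e \<bullet> (mat_of X *v e) = x"
    by (simp add: e_def x_def inner_axis' matrix_vector_axis_nth)
  \<comment> \<open>The vector below minimizes the quadratic form along \<open>v + \<real> e\<close>.\<close>
  have "0 \<le> (v - (s / x) *\<^sub>R e) \<bullet> (mat_of X *v (v - (s / x) *\<^sub>R e))"
    using X by (simp add: psd_def)
  also have "\<dots> = v \<bullet> (mat_of X *v v) - (s / x) * s - (s / x) * (e \<bullet> (mat_of X *v v))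
      + (s / x) * ((s / x) * x)"
    by (simp add: matrix_vector_mult_diff_distrib matrix_vector_mult_scaleR inner_diff_left
        inner_diff_right s_def[symmetric] xe right_diff_distrib)
  also have "e \<bullet> (mat_of X *v v) = s"
    unfolding s_def by (metis inner_commute inner_matrix_vector_left)
  also have "v \<bullet> (mat_of X *v v) - (s / x) * s - (s / x) * s + (s / x) * ((s / x) * x)
      = v \<bullet> (mat_of X *v v) - s * s / x"
    using k by (simp add: x_def)
  also have "\<dots> = (X - outer ((1 / sqrt x) *\<^sub>R (mat_of X *v e))) \<bullet> outer v"
    using k unfolding x_def[symmetric]
    by (simp add: inner_diff_left[of X] outer_scale inner_outer outer_matrix_vector s_def[symmetric] s'
        matrix_vector_mult_diff_rdistrib inner_diff_right
        scaleR_matrix_vector_assoc[symmetric])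
  finally show "0 \<le> (X - outer ((1 / sqrt (mat_of X $ k $ k)) *\<^sub>R (mat_of X *v axis k 1))) \<bullet> outer v"
    unfolding x_def e_def .
qed

text \<open>The set \<open>K\<close> contains the indices of all columns that have not been cleared yet.\<close>

lemma psd_imp_sum_outer_aux:
  fixes X :: "'n::finite symmat"
  assumes "finite K" "psd X" "\<And>i. i \<notin> K \<Longrightarrow> mat_of X *v axis i 1 = 0"
  shows "\<exists>u. X = (\<Sum>i\<in>K. outer (u i))"
  using assms
proof (induction K arbitrary: X rule: finite_induct)
  case empty
  then have "mat_of X $ j $ i = 0" for i j
    by (metis empty_iff matrix_vector_axis_nth zero_index)
  then show ?case by (simp add: symmat_eq_iff)
next
  case (insert k K)
  define x where "x = mat_of X $ k $ k"
  have x: "x = axis k 1 \<bullet> (mat_of X *v axis k 1)"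
    by (simp add: x_def inner_axis' matrix_vector_axis_nth)
  then have "x \<ge> 0" using insert.prems(1) by (simp add: psd_def)
  define w where "w = (if x = 0 then 0 else (1 / sqrt x) *\<^sub>R (mat_of X *v axis k 1))"
  have "psd (X - outer w)"
    using psd_pivot[OF insert.prems(1), of k] insert.prems(1) \<open>x \<ge> 0\<close> by (simp add: w_def x_def)
  moreover have "mat_of (X - outer w) *v axis i 1 = 0" if "i \<notin> K" for i
  proof (cases "x = 0")
    case True
    then have "mat_of X *v axis k 1 = 0"
      using psd_kernel[OF insert.prems(1)] x by simp
    then show ?thesis using insert.prems(2)[of i] that True by (cases "i = k") (simp_all add: w_def)
  next
    case False
    show ?thesis
    proof (cases "i = k")
      case True
      have "w \<bullet> axis k 1 = x / sqrt x"
        using False by (simp add: w_def inner_axis x_def matrix_vector_axis_nth)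
      then have "(w \<bullet> axis k 1) *\<^sub>R w = mat_of X *v axis k 1"
        using False \<open>x \<ge> 0\<close> by (simp add: w_def)
      then show ?thesis
        using True by (simp add: matrix_vector_mult_diff_rdistrib outer_matrix_vector)
    next
      case False
      then have *: "mat_of X *v axis i 1 = 0" using insert.prems(2)[of i] that by simp
      then have "mat_of X $ i $ k = 0"
        by (metis mat_of_commute matrix_vector_axis_nth zero_index)
      then have "w \<bullet> axis i 1 = 0"
        by (simp add: w_def inner_axis matrix_vector_axis_nth)
      then show ?thesis
        using * by (simp add: matrix_vector_mult_diff_rdistrib outer_matrix_vector)
    qed
  qed
  ultimately obtain u where u: "X - outer w = (\<Sum>i\<in>K. outer (u i))"
    using insert.IH by metis
  have "X = outer w + (\<Sum>i\<in>K. outer (u i))" using u by (simp add: algebra_simps)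
  also have "\<dots> = (\<Sum>i\<in>insert k K. outer ((u(k := w)) i))"
  proof -
    have "(\<Sum>i\<in>K. outer ((u(k := w)) i)) = (\<Sum>i\<in>K. outer (u i))"
      using insert.hyps by (intro sum.cong) auto
    then show ?thesis using insert.hyps by simp
  qed
  finally show ?case by blast
qed

lemma psd_imp_sum_outer:
  fixes X :: "'n::finite symmat"
  assumes "psd X"
  obtains u :: "'n \<Rightarrow> real ^ 'n" where "X = (\<Sum>i\<in>UNIV. outer (u i))"
proof -
  have "\<exists>u. X = (\<Sum>i\<in>(UNIV :: 'n set). outer (u i))"
    by (rule psd_imp_sum_outer_aux) (use assms in simp_all)
  then show ?thesis by (elim exE that)
qed

lemma psd_inner_nonneg:
  fixes X :: "'n::finite symmat"
  assumes "psd X" "psd Z" shows "0 \<le> X \<bullet> Z"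
proof -
  obtain u :: "'n \<Rightarrow> real ^ 'n" where u: "X = (\<Sum>i\<in>UNIV. outer (u i))"
    by (rule psd_imp_sum_outer[OF assms(1)])
  have "0 \<le> outer v \<bullet> Z" for v using assms(2) by (simp add: psd_iff_outer inner_commute)
  then show ?thesis unfolding u inner_sum_left by (intro sum_nonneg)
qed

lemma psd_inner_zero:
  fixes X :: "'n::finite symmat"
  assumes "psd X" "psd Z" "X \<bullet> Z = 0"
  shows "mat_of Z *v (mat_of X *v v) = 0"
proof -
  obtain u :: "'n \<Rightarrow> real ^ 'n" where u: "X = (\<Sum>i\<in>UNIV. outer (u i))"
    by (rule psd_imp_sum_outer[OF assms(1)])
  have "0 \<le> outer v \<bullet> Z" for v using assms(2) by (simp add: psd_iff_outer inner_commute)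
  then have "\<forall>i. outer (u i) \<bullet> Z = 0"
    using assms(3) unfolding u inner_sum_left by (simp add: sum_nonneg_eq_0_iff)
  then have Z: "mat_of Z *v u i = 0" for i
    using psd_kernel[OF assms(2)] by (simp add: inner_commute inner_outer)
  have "mat_of X *v v = (\<Sum>i\<in>UNIV. mat_of (outer (u i)) *v v)"
    unfolding u by (rule linear_sum[OF linear_matrix_vector_symmat])
  then show ?thesis
    by (simp add: outer_matrix_vector linear_sum[OF matrix_vector_mul_linear]
        matrix_vector_mult_scaleR Z)
qed

text \<open>The identity matrix as an element of the space of symmetric matrices.\<close>

definition ident :: "'n::finite symmat" where
  "ident = Abs_symmat (mat 1)"

lemma mat_of_ident [simp]: "mat_of ident = mat 1"
  unfolding ident_def by (rule Abs_symmat_inverse) simp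

lemma inner_ident_outer: "ident \<bullet> outer v = v \<bullet> v"
  by (simp add: inner_outer)

lemma norm_le_trace:
  fixes X :: "'n::finite symmat"
  assumes "psd X" shows "norm X \<le> ident \<bullet> X"
proof -
  obtain u :: "'n \<Rightarrow> real ^ 'n" where u: "X = (\<Sum>i\<in>UNIV. outer (u i))"
    by (rule psd_imp_sum_outer[OF assms])
  have "norm X \<le> (\<Sum>i\<in>UNIV. norm (outer (u i)))" unfolding u by (rule norm_sum)
  also have "\<dots> = ident \<bullet> X"
    unfolding u inner_sum_right by (simp add: norm_outer inner_ident_outer)
  finally show ?thesis .
qed

lemma psd_shift_ident:
  assumes "norm N \<le> c" shows "psd (c *\<^sub>R ident + N)"
  unfolding psd_iff_outer
proof
  fix v
  have "\<bar>N \<bullet> outer v\<bar> \<le> c * (v \<bullet> v)"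
    using Cauchy_Schwarz_ineq2[of N "outer v"] assms
    by (smt (verit) inner_ge_zero mult_right_mono norm_outer)
  then show "0 \<le> (c *\<^sub>R ident + N) \<bullet> outer v"
    by (simp add: inner_add_left inner_ident_outer)
qed

section \<open>Ranks of complementary matrices\<close>

lemma rank_diff_le:
  fixes A B :: "real ^ 'n ^ 'm"
  shows "rank (A - B) \<le> rank A + rank B"
proof -
  let ?S = "range ((*v) A)" and ?T = "range ((*v) B)"
  have sub: "subspace ?S" "subspace ?T"
    by (simp_all add: linear_subspace_image)
  have "(*v) (A - B) v = A *v v + B *v (- v)" for v
    by (simp add: matrix_vector_mult_diff_rdistrib linear_neg[OF matrix_vector_mul_linear])
  then have "range ((*v) (A - B)) \<subseteq> {x + y |x y. x \<in> ?S \<and> y \<in> ?T}" by blast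
  then have "rank (A - B) \<le> dim {x + y |x y. x \<in> ?S \<and> y \<in> ?T}"
    unfolding rank_dim_range by (rule dim_subset)
  also have "\<dots> \<le> rank A + rank B"
    using dim_sums_Int[OF sub] by (simp add: rank_dim_range)
  finally show ?thesis .
qed

lemma dim_sum_ranges:
  fixes X Z :: "'n::finite symmat"
  assumes ZX: "\<And>v. mat_of Z *v (mat_of X *v v) = 0"
  shows "dim {x + y |x y. x \<in> range ((*v) (mat_of X)) \<and> y \<in> range ((*v) (mat_of Z))}
    = rank (mat_of X) + rank (mat_of Z)"
proof -
  let ?S = "range ((*v) (mat_of X))" and ?T = "range ((*v) (mat_of Z))"
  have sub: "subspace ?S" "subspace ?T"
    by (simp_all add: linear_subspace_image)
  have "x = 0" if x: "x \<in> ?S \<inter> ?T" for x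
  proof -
    obtain a where a: "x = mat_of X *v a" using x by auto
    obtain b where b: "x = mat_of Z *v b" using x by auto
    have "x \<bullet> x = (mat_of Z *v b) \<bullet> (mat_of X *v a)" by (simp flip: a b)
    also have "\<dots> = 0" by (simp add: inner_matrix_vector_left ZX)
    finally show ?thesis by simp
  qed
  moreover have "0 \<in> ?S \<inter> ?T" using sub by (simp add: subspace_0)
  ultimately have "?S \<inter> ?T = {0}" by blast
  then show ?thesis using dim_sums_Int[OF sub] by (simp add: rank_dim_range)
qed

lemma rank_add_le:
  fixes X Z :: "'n::finite symmat"
  assumes "\<And>v. mat_of Z *v (mat_of X *v v) = 0"
  shows "rank (mat_of X) + rank (mat_of Z) \<le> CARD('n)"
  unfolding dim_sum_ranges[OF assms, symmetric]
  using dim_subset_UNIV[where 'a = "real ^ 'n"] by simp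

lemma common_kernel_trivial:
  fixes X Z :: "'n::finite symmat"
  assumes ZX: "\<And>v. mat_of Z *v (mat_of X *v v) = 0"
    and rank: "rank (mat_of X) + rank (mat_of Z) = CARD('n)"
    and v: "mat_of X *v v = 0" "mat_of Z *v v = 0"
  shows "v = 0"
proof -
  let ?S = "range ((*v) (mat_of X))" and ?T = "range ((*v) (mat_of Z))"
  let ?U = "{x + y |x y. x \<in> ?S \<and> y \<in> ?T}"
  have "subspace ?U"
    by (intro subspace_sums) (simp_all add: linear_subspace_image)
  moreover have "dim ?U = DIM(real ^ 'n)"
    using dim_sum_ranges[OF ZX] rank by simp
  ultimately have "?U = UNIV"
    using dim_eq_full[of ?U] by (simp only: span_eq_iff[THEN iffD2])
  then have "v \<in> ?U" by (simp only: UNIV_I)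
  then obtain a b where "v = mat_of X *v a + mat_of Z *v b" by auto
  then have "v \<bullet> v = v \<bullet> (mat_of X *v a) + v \<bullet> (mat_of Z *v b)"
    using inner_add_right[of v "mat_of X *v a" "mat_of Z *v b"] by simp
  also have "\<dots> = 0" using v by (simp flip: inner_matrix_vector_left)
  finally show ?thesis by simp
qed

section \<open>Perturbation of positive definite matrices\<close>

lemma posdef_perturb:
  fixes X :: "'n::finite symmat"
  assumes pos: "\<And>v. v \<noteq> 0 \<Longrightarrow> 0 < v \<bullet> (mat_of X *v v)"
  shows "\<exists>e>0. \<forall>N. norm N \<le> e \<longrightarrow> psd (X + N)"
proof -
  let ?q = "\<lambda>v. v \<bullet> (mat_of X *v v)"
  have cont: "continuous_on (sphere 0 1) ?q"
    by (intro continuous_intros linear_continuous_on)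
  have ne: "sphere (0 :: real ^ 'n) 1 \<noteq> {}" by simp
  obtain w where w: "w \<in> sphere 0 1" "\<And>v. v \<in> sphere 0 1 \<Longrightarrow> ?q w \<le> ?q v"
    using continuous_attains_inf[OF compact_sphere ne cont] by auto
  \<comment> \<open>\<open>c\<close> is the smallest eigenvalue of \<open>X\<close>.\<close>
  define c where "c = ?q w"
  have "w \<noteq> 0" using w(1) by auto
  then have c: "c > 0" using pos[of w] by (simp add: c_def)
  have "psd (X - c *\<^sub>R ident)"
    unfolding psd_iff_outer
  proof
    fix v :: "real ^ 'n"
    show "0 \<le> (X - c *\<^sub>R ident) \<bullet> outer v"
    proof (cases "v = 0")
      case False
      then have "c \<le> ?q ((1 / norm v) *\<^sub>R v)" unfolding c_def by (intro w(2)) simp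
      also have "\<dots> = ?q v / (norm v)\<^sup>2"
        by (simp add: matrix_vector_mult_scaleR power2_eq_square)
      finally have "c * (norm v)\<^sup>2 \<le> ?q v" using False by (simp add: divide_simps)
      then show ?thesis
        by (simp add: inner_diff_left[of X] inner_ident_outer inner_outer[of X] power2_norm_eq_inner)
    qed simp
  qed
  then have "psd ((X - c *\<^sub>R ident) + (c *\<^sub>R ident + N))" if "norm N \<le> c" for N
    using that by (intro psd_add psd_shift_ident)
  then show ?thesis using c by (intro exI[of _ c]) simp
qed

section \<open>Duality\<close>

lemma linear_constraint_map: "linear (constraint_map A)"
  by (rule linearI) (simp_all add: constraint_map_def vec_eq_iff inner_add_right)

lemma linear_constraint_adjoint: "linear (constraint_adjoint A)"
  by (rule linearI)
    (simp_all add: constraint_adjoint_def scaleR_add_left sum.distrib scaleR_sum_right)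

lemma constraint_adjoint_inner:
  "constraint_adjoint A y \<bullet> X = y \<bullet> constraint_map A X"
  by (simp add: constraint_adjoint_def constraint_map_def inner_sum_left inner_vec_def)

lemma objective_gap:
  assumes "constraint_map A X = b"
  shows "C \<bullet> X - b \<bullet> y = X \<bullet> (C - constraint_adjoint A y)"
  using assms
  by (simp add: inner_diff_right inner_commute[of X] constraint_adjoint_inner inner_commute[of b])

text \<open>
  Under Slater's condition a lower bound \<open>p\<close> for the primal problem is matched by a dual feasible
  point.  The convex set \<open>K\<close> of all \<open>(A X - b, \<langle>C, X\<rangle> - p + t)\<close> with \<open>X\<close> in the cone and \<open>t > 0\<close>
  avoids the origin; the normal \<open>(u, w)\<close> of a separating hyperplane has \<open>w > 0\<close> by Slater's
  condition, and \<open>y = - u / w\<close> is the dual point.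
\<close>

lemma slater_dual_attained:
  fixes A :: "'m::finite \<Rightarrow> 'n::finite symmat"
  assumes surj: "surj (constraint_map A)"
    and X0: "constraint_map A X0 = b" "\<And>v. v \<noteq> 0 \<Longrightarrow> 0 < v \<bullet> (mat_of X0 *v v)"
    and p: "\<And>X. primal_feasible A b X \<Longrightarrow> p \<le> C \<bullet> X"
  shows "\<exists>y. dual_feasible A C y \<and> p \<le> b \<bullet> y"
proof -
  obtain e where e: "e > 0" "\<And>N. norm N \<le> e \<Longrightarrow> psd (X0 + N)"
    using posdef_perturb[OF X0(2)] by auto
  let ?A = "constraint_map A"
  note lin = linear_constraint_map[of A]
  let ?K = "{(?A X - b, C \<bullet> X - p + t) | X t. psd X \<and> t > 0}"
  have "convex ?K"
  proof (rule convexI)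
    fix x y and u v :: real
    assume "x \<in> ?K" "y \<in> ?K" and uv: "0 \<le> u" "0 \<le> v" "u + v = 1"
    then obtain X s Y t where x: "x = (?A X - b, C \<bullet> X - p + s)" "psd X" "s > 0"
      and y: "y = (?A Y - b, C \<bullet> Y - p + t)" "psd Y" "t > 0" by blast
    have v: "u = 1 - v" using uv by simp
    have ub: "u *\<^sub>R b + v *\<^sub>R b = b" and up: "u * p + v * p = p"
      by (simp_all add: v algebra_simps)
    have "u *\<^sub>R x + v *\<^sub>R y = (?A (u *\<^sub>R X + v *\<^sub>R Y) - (u *\<^sub>R b + v *\<^sub>R b),
        C \<bullet> (u *\<^sub>R X + v *\<^sub>R Y) - (u * p + v * p) + (u * s + v * t))"
      by (simp add: x y linear_add[OF lin] linear_scale[OF lin] inner_add_right algebra_simps)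
    then have "u *\<^sub>R x + v *\<^sub>R y = (?A (u *\<^sub>R X + v *\<^sub>R Y) - b,
        C \<bullet> (u *\<^sub>R X + v *\<^sub>R Y) - p + (u * s + v * t))"
      unfolding ub up .
    moreover have "psd (u *\<^sub>R X + v *\<^sub>R Y)" using x y uv by (intro psd_add psd_scaleR)
    moreover have "u * s + v * t > 0"
    proof (cases "u = 0")
      case False
      then have "u * s > 0" using uv x by simp
      then show ?thesis using uv y by (simp add: add_pos_nonneg)
    qed (use uv y in simp)
    ultimately show "u *\<^sub>R x + v *\<^sub>R y \<in> ?K" by blast
  qed
  moreover have "0 \<notin> ?K"
  proof
    assume "0 \<in> ?K"
    then obtain X t where "?A X = b" "C \<bullet> X - p + t = 0" "psd X" "t > 0"
      by (auto simp: zero_prod_def)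
    then show False using p[of X] by (simp add: primal_feasible_def)
  qed
  ultimately obtain a where a: "a \<noteq> 0" "\<forall>x\<in>?K. 0 \<le> a \<bullet> x"
    using separating_hyperplane_set_0 by blast
  obtain u w where uw: "a = (u, w)" by (cases a)
  have sep: "0 \<le> u \<bullet> (?A X - b) + w * (C \<bullet> X - p + t)" if "psd X" "t > 0" for X t
    using a(2) that unfolding uw by fastforce
  have psd0: "psd X0" using e(2)[of 0] e(1) by simp
  have w0: "w \<ge> 0"
  proof (rule ccontr)
    assume "\<not> w \<ge> 0"
    \<comment> \<open>Large \<open>t\<close> violate \<open>sep\<close>; this one gives a value of at most \<open>- 1\<close>.\<close>
    define t where "t = (\<bar>w * (C \<bullet> X0 - p)\<bar> + 1) / (- w)"
    have "t > 0" and wt: "w * t = - (\<bar>w * (C \<bullet> X0 - p)\<bar> + 1)"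
      using \<open>\<not> w \<ge> 0\<close> by (auto simp: t_def divide_neg_pos field_simps)
    then show False using sep[OF psd0, of t] X0(1) by (simp add: distrib_left)
  qed
  have "w \<noteq> 0"
  proof
    assume "w = 0"
    define H where "H = constraint_adjoint A u"
    have "H = 0"
    proof (rule ccontr)
      assume "H \<noteq> 0"
      \<comment> \<open>Move from \<open>X0\<close> against the gradient \<open>H\<close> without leaving the cone.\<close>
      define s where "s = e / norm H"
      have s: "s > 0" "norm (- s *\<^sub>R H) \<le> e" using \<open>H \<noteq> 0\<close> e(1) by (simp_all add: s_def)
      have "0 \<le> u \<bullet> ?A (- s *\<^sub>R H)"
        using sep[OF e(2)[OF s(2)], of 1] \<open>w = 0\<close> X0(1) unfolding linear_add[OF lin] by simp
      also have "\<dots> = - s * (H \<bullet> H)"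
        by (simp add: H_def flip: constraint_adjoint_inner)
      finally have "s * (H \<bullet> H) \<le> 0" by simp
      moreover have "s * (H \<bullet> H) > 0" using s(1) \<open>H \<noteq> 0\<close> by simp
      ultimately show False by simp
    qed
    moreover obtain X where "?A X = u" using surj by (metis surjD)
    ultimately have "u \<bullet> u = 0" using constraint_adjoint_inner[of A u X] by (simp add: H_def)
    then show False using a(1) uw \<open>w = 0\<close> by (simp add: zero_prod_def)
  qed
  with w0 have w: "w > 0" by simp
  define y where "y = (- 1 / w) *\<^sub>R u"
  define Z where "Z = C - constraint_adjoint A y"
  have u: "u = - w *\<^sub>R y" using w by (simp add: y_def)
  have main: "0 \<le> Z \<bullet> X + (b \<bullet> y - p)" if "psd X" for X
  proof (rule field_le_epsilon)
    fix t :: real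
    assume "t > 0"
    have "0 \<le> u \<bullet> (?A X - b) + w * (C \<bullet> X - p + t)" by (rule sep) fact+
    also have "\<dots> = w * (Z \<bullet> X + (b \<bullet> y - p) + t)"
      by (simp add: Z_def u inner_diff_left inner_diff_right constraint_adjoint_inner
          inner_commute[of y b] algebra_simps)
    finally show "0 \<le> Z \<bullet> X + (b \<bullet> y - p) + t" using w by (simp add: zero_le_mult_iff)
  qed
  have "p \<le> b \<bullet> y" using main[OF psd_zero] by simp
  moreover have "psd Z"
    unfolding psd_iff_outer
  proof (intro allI, rule ccontr)
    fix v
    assume "\<not> 0 \<le> Z \<bullet> outer v"
    \<comment> \<open>Scaling \<open>outer v\<close> by this \<open>s\<close> makes the expression in \<open>main\<close> equal to \<open>- 1\<close>.\<close>
    define s where "s = (b \<bullet> y - p + 1) / (- (Z \<bullet> outer v))"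
    have "s \<ge> 0" and s: "s * (Z \<bullet> outer v) = - (b \<bullet> y - p + 1)"
      using \<open>\<not> 0 \<le> Z \<bullet> outer v\<close> \<open>p \<le> b \<bullet> y\<close> by (auto simp: s_def divide_nonneg_neg field_simps)
    then show False using main[OF psd_scaleR[OF \<open>s \<ge> 0\<close> psd_outer[of v]]] by simp
  qed
  ultimately show ?thesis by (auto simp: dual_feasible_def Z_def)
qed

section \<open>Simplicity away from degenerate costs\<close>

text \<open>
  The costs \<open>C\<close> for which some primal-dual pair without duality gap violates strict
  complementarity.  A feasible pair with \<open>\<langle>X, C - A\<^sup>* y\<rangle> = 0\<close> is automatically optimal on both
  sides, so optimality need not be mentioned.
\<close>

definition degenerate_costs ::
  "('m::finite \<Rightarrow> 'n::finite symmat) \<Rightarrow> real ^ 'm \<Rightarrow> 'n symmat set" where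
  "degenerate_costs A b = {C. \<exists>X y. primal_feasible A b X \<and> dual_feasible A C y \<and>
     X \<bullet> (C - constraint_adjoint A y) = 0 \<and>
     rank (mat_of X) + rank (mat_of (C - constraint_adjoint A y)) < CARD('n)}"

text \<open>If \<open>A\<^sup>* y0\<close> is the identity, then all feasible matrices have trace \<open>\<langle>b, y0\<rangle>\<close>.\<close>

lemma compact_feasible:
  fixes A :: "'m::finite \<Rightarrow> 'n::finite symmat"
  assumes y0: "constraint_adjoint A y0 = ident"
  shows "compact {X. primal_feasible A b X}"
proof -
  have "closed (constraint_map A -` {b} \<inter> {X. psd X})"
    by (intro closed_Int closed_psd continuous_closed_vimage linear_continuous_at
        linear_constraint_map[unfolded linear_conv_bounded_linear]) simp
  moreover have "constraint_map A -` {b} \<inter> {X. psd X} = {X. primal_feasible A b X}"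
    by (auto simp: primal_feasible_def)
  moreover have "norm X \<le> y0 \<bullet> b" if "primal_feasible A b X" for X
    using norm_le_trace[of X] that y0 constraint_adjoint_inner[of A y0 X]
    by (simp add: primal_feasible_def)
  then have "bounded {X. primal_feasible A b X}" by (auto simp: bounded_iff)
  ultimately show ?thesis by (simp add: compact_eq_bounded_closed)
qed

text \<open>
  The line through two solutions stays in the affine feasible set and in the kernel condition
  \<open>Z X = 0\<close>.  At the last point \<open>X\<close> of the line inside the cone, \<open>rank X + rank Z = n\<close> would make
  \<open>X + Z\<close> positive definite, so that \<open>X\<close> could be moved further along the line.
\<close>

lemma nonunique_imp_degenerate:
  fixes A :: "'m::finite \<Rightarrow> 'n::finite symmat"
  assumes y0: "constraint_adjoint A y0 = ident"
    and X1: "primal_feasible A b X1" "X1 \<bullet> Z = 0"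
    and X2: "primal_feasible A b X2" "X2 \<bullet> Z = 0"
    and "X1 \<noteq> X2" and Z: "psd Z"
  shows "\<exists>X. primal_feasible A b X \<and> X \<bullet> Z = 0 \<and>
    rank (mat_of X) + rank (mat_of Z) < CARD('n)"
proof -
  note lin = linear_constraint_map[of A]
  define H where "H = X2 - X1"
  have "H \<noteq> 0" using \<open>X1 \<noteq> X2\<close> by (simp add: H_def)
  have AH: "constraint_map A H = 0"
    using X1 X2 by (simp add: H_def primal_feasible_def linear_diff[OF lin])
  have ZH: "mat_of Z *v (mat_of H *v v) = 0" for v
    using psd_inner_zero[OF _ Z X1(2), of v] psd_inner_zero[OF _ Z X2(2), of v] X1 X2
    by (simp add: H_def primal_feasible_def matrix_vector_mult_diff_rdistrib
        matrix_vector_mult_diff_distrib)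
  have feas: "primal_feasible A b (X1 + t *\<^sub>R H) \<longleftrightarrow> psd (X1 + t *\<^sub>R H)" for t
    using X1 AH by (simp add: primal_feasible_def linear_add[OF lin] linear_scale[OF lin])
  define T where "T = (\<lambda>t. X1 + t *\<^sub>R H) -` {X. primal_feasible A b X}"
  have comp: "compact {X. primal_feasible A b X}" using y0 by (rule compact_feasible)
  have "closed T"
    unfolding T_def
    by (intro continuous_closed_vimage compact_imp_closed comp) (simp add: continuous_intros)
  moreover have "bounded T"
  proof -
    obtain R where R: "\<And>X. primal_feasible A b X \<Longrightarrow> norm X \<le> R"
      using compact_imp_bounded[OF comp] by (auto simp: bounded_iff)
    have "norm t \<le> (R + norm X1) / norm H" if "t \<in> T" for t
    proof -
      have "norm (t *\<^sub>R H) \<le> norm (X1 + t *\<^sub>R H) + norm X1"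
        using norm_triangle_ineq4[of "X1 + t *\<^sub>R H" X1] by simp
      also have "\<dots> \<le> R + norm X1" using R that by (simp add: T_def)
      finally show ?thesis using \<open>H \<noteq> 0\<close> by (simp add: pos_le_divide_eq)
    qed
    then show ?thesis unfolding bounded_iff by blast
  qed
  moreover have "0 \<in> T" using X1 by (simp add: T_def)
  ultimately obtain t where t: "t \<in> T" "\<And>s. s \<in> T \<Longrightarrow> s \<le> t"
    using compact_attains_sup[of T] by (auto simp: compact_eq_bounded_closed)
  define X where "X = X1 + t *\<^sub>R H"
  have X: "primal_feasible A b X" "X \<bullet> Z = 0" "psd X"
    using t(1) X1 X2 by (auto simp: T_def X_def H_def inner_add_left inner_diff_left primal_feasible_def)
  have ZX: "mat_of Z *v (mat_of X *v v) = 0" for v using X Z by (simp add: psd_inner_zero)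
  have "rank (mat_of X) + rank (mat_of Z) \<noteq> CARD('n)"
  proof
    assume rank: "rank (mat_of X) + rank (mat_of Z) = CARD('n)"
    have "0 < v \<bullet> (mat_of (X + Z) *v v)" if "v \<noteq> 0" for v
    proof -
      have "0 \<le> v \<bullet> (mat_of X *v v)" "0 \<le> v \<bullet> (mat_of Z *v v)"
        using X(3) Z by (simp_all add: psd_def)
      moreover have "v \<bullet> (mat_of X *v v) \<noteq> 0 \<or> v \<bullet> (mat_of Z *v v) \<noteq> 0"
        using common_kernel_trivial[OF ZX rank] psd_kernel[OF X(3)] psd_kernel[OF Z] that by blast
      ultimately show ?thesis
        by (auto simp: matrix_vector_mult_add_rdistrib inner_add_right)
    qed
    then obtain e where e: "e > 0" "\<And>N. norm N \<le> e \<Longrightarrow> psd (X + Z + N)"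
      using posdef_perturb[of "X + Z"] by auto
    define s where "s = e / norm H"
    have s: "s > 0" "norm (s *\<^sub>R H) \<le> e" using \<open>H \<noteq> 0\<close> e by (simp_all add: s_def)
    define Y where "Y = X + s *\<^sub>R H"
    have ZY: "mat_of Z *v (mat_of Y *v v) = 0" for v
      using ZX[of v] ZH[of v]
      by (simp add: Y_def matrix_vector_mult_add_rdistrib matrix_vector_right_distrib
          matrix_vector_mult_scaleR scaleR_matrix_vector_assoc[symmetric])
    have YZ: "mat_of Y *v (mat_of Z *v v) = 0" (is "?w = 0") for v
    proof -
      have "?w \<bullet> ?w = (mat_of Z *v (mat_of Y *v ?w)) \<bullet> v"
        unfolding inner_matrix_vector_left by (rule refl)
      then show ?thesis by (simp add: ZY)
    qed
    have "psd Y"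
      unfolding psd_def
    proof
      fix v :: "real ^ 'n"
      \<comment> \<open>On the range of \<open>Z\<close> the form of \<open>Y\<close> vanishes, on the kernel it agrees with \<open>Y + Z\<close>.\<close>
      obtain w k where w: "w \<in> span (range ((*v) (mat_of Z)))"
        and k: "\<And>x. x \<in> span (range ((*v) (mat_of Z))) \<Longrightarrow> orthogonal k x" and v: "v = w + k"
        using orthogonal_subspace_decomp_exists[of "range ((*v) (mat_of Z))" v] by blast
      have "w \<in> range ((*v) (mat_of Z))"
        using w by (simp only: span_eq_iff[THEN iffD2]
            linear_subspace_image[OF matrix_vector_mul_linear subspace_UNIV])
      then have Yw: "mat_of Y *v w = 0" using YZ by blast
      have "k \<bullet> (mat_of Z *v (mat_of Z *v k)) = 0"
        using k[OF span_base, of "mat_of Z *v (mat_of Z *v k)"] by (simp add: orthogonal_def)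
      then have Zk: "mat_of Z *v k = 0"
        by (simp flip: inner_matrix_vector_left[of Z k])
      have Yv: "mat_of Y *v v = mat_of Y *v k"
        using Yw by (simp add: v matrix_vector_right_distrib)
      have "v \<bullet> (mat_of Y *v v) = v \<bullet> (mat_of Y *v k)" by (simp only: Yv)
      also have "\<dots> = (mat_of Y *v v) \<bullet> k" by (rule inner_matrix_vector_left[symmetric])
      also have "\<dots> = k \<bullet> (mat_of Y *v k)" unfolding Yv by (rule inner_commute)
      also have "mat_of Y *v k = mat_of (X + Z + s *\<^sub>R H) *v k"
        using Zk by (simp add: Y_def matrix_vector_mult_add_rdistrib)
      finally have "v \<bullet> (mat_of Y *v v) = k \<bullet> (mat_of (X + Z + s *\<^sub>R H) *v k)" .
      then show "0 \<le> v \<bullet> (mat_of Y *v v)" using e(2)[OF s(2)] by (simp add: psd_def)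
    qed
    then have "t + s \<in> T" using feas[of "t + s"] by (simp add: T_def X_def Y_def scaleR_add_left add.assoc)
    then show False using t(2) s(1) by fastforce
  qed
  then show ?thesis using X rank_add_le[OF ZX] by (metis le_neq_implies_less)
qed

lemma surj_constraint_map:
  fixes A :: "'m::finite \<Rightarrow> 'n::finite symmat"
  assumes "\<And>u. constraint_adjoint A u = 0 \<Longrightarrow> u = 0"
  shows "surj (constraint_map A)"
proof (rule ccontr)
  assume "\<not> surj (constraint_map A)"
  moreover have "span (range (constraint_map A)) = range (constraint_map A)"
    by (simp add: span_eq_iff linear_subspace_image linear_constraint_map)
  ultimately obtain u where u: "u \<noteq> 0" "\<And>X. u \<bullet> constraint_map A X = 0"
    using span_not_UNIV_orthogonal[of "range (constraint_map A)"] by (metis rangeI)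
  then have "constraint_adjoint A u \<bullet> X = 0" for X by (simp add: constraint_adjoint_inner)
  from this[of "constraint_adjoint A u"] have "constraint_adjoint A u = 0" by simp
  then show False using assms u(1) by blast
qed

text \<open>
  The hypotheses express, in this order, boundedness of the feasible set, Slater's condition at \<open>X0\<close>, and
  injectivity of \<open>u \<mapsto> (A\<^sup>* u) X\<close> for all \<open>X\<close> on the affine feasible set.
\<close>

lemma simple_sdp_if_not_degenerate:
  fixes A :: "'m::finite \<Rightarrow> 'n::finite symmat"
  assumes y0: "constraint_adjoint A y0 = ident"
    and X0: "constraint_map A X0 = b" "\<And>v. v \<noteq> 0 \<Longrightarrow> 0 < v \<bullet> (mat_of X0 *v v)"
    and indep: "\<And>X u. constraint_map A X = b \<Longrightarrow>
      (\<And>v. mat_of (constraint_adjoint A u) *v (mat_of X *v v) = 0) \<Longrightarrow> u = 0"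
    and C: "C \<notin> degenerate_costs A b"
  shows "simple_sdp A b C"
proof -
  have surj: "surj (constraint_map A)"
    by (rule surj_constraint_map) (use indep[OF X0(1)] in simp)
  have "psd X0" unfolding psd_def
  proof
    fix v show "0 \<le> v \<bullet> (mat_of X0 *v v)" using X0(2)[of v] by (cases "v = 0") auto
  qed
  then have "primal_feasible A b X0" using X0 by (simp add: primal_feasible_def)
  then have ne: "{X. primal_feasible A b X} \<noteq> {}" by auto
  obtain X where X: "primal_feasible A b X" "\<And>X'. primal_feasible A b X' \<Longrightarrow> C \<bullet> X \<le> C \<bullet> X'"
    using continuous_attains_inf[OF compact_feasible[OF y0] ne continuous_on_inner[OF
        continuous_on_const continuous_on_id], of C] by auto
  obtain y where y: "dual_feasible A C y" "C \<bullet> X \<le> b \<bullet> y"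
    using slater_dual_attained[OF surj X0 X(2)] by blast
  have gap: "C \<bullet> X' - b \<bullet> y' = X' \<bullet> (C - constraint_adjoint A y')"
    and weak: "dual_feasible A C y' \<Longrightarrow> b \<bullet> y' \<le> C \<bullet> X'"
    if "primal_feasible A b X'" for X' y'
    using that objective_gap[of A X' b C y'] psd_inner_nonneg[of X' "C - constraint_adjoint A y'"]
    by (simp_all add: primal_feasible_def dual_feasible_def)
  have value_eq: "C \<bullet> X = b \<bullet> y" using y weak[OF X(1) y(1)] by simp
  have sol_p: "primal_solution A b C X' \<longleftrightarrow> primal_feasible A b X' \<and> C \<bullet> X' = C \<bullet> X" for X'
    unfolding primal_solution_def is_arg_min_linorder using X by (auto intro: antisym)
  have sol_d: "dual_solution A b C y' \<longleftrightarrow> dual_feasible A C y' \<and> b \<bullet> y' = C \<bullet> X" for y'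
    unfolding dual_solution_def is_arg_max_linorder using y value_eq weak[OF X(1)]
    by (metis order.antisym)
  have kkt: "X' \<bullet> (C - constraint_adjoint A y') = 0"
    if "primal_solution A b C X'" "dual_solution A b C y'" for X' y'
    using that gap[of X' y'] by (simp add: sol_p sol_d)
  have pX: "primal_solution A b C X" and dy: "dual_solution A b C y"
    using X y value_eq by (simp_all add: sol_p sol_d)
  have psdX: "psd X" and psdZ: "psd (C - constraint_adjoint A y)"
    using X y by (simp_all add: primal_feasible_def dual_feasible_def)
  have "strong_duality A b C"
    unfolding strong_duality_def objective_eq_trace[symmetric]
    using pX dy by (auto simp: sol_p sol_d)
  moreover have "strict_complementarity A b C"
  proof -
    have "rank (mat_of X) + rank (mat_of (C - constraint_adjoint A y)) \<le> CARD('n)"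
      by (intro rank_add_le psd_inner_zero psdX psdZ kkt pX dy)
    moreover have "\<not> rank (mat_of X) + rank (mat_of (C - constraint_adjoint A y)) < CARD('n)"
      using C X(1) y(1) kkt[OF pX dy] unfolding degenerate_costs_def by blast
    ultimately show ?thesis unfolding strict_complementarity_def using pX dy by fastforce
  qed
  moreover have "X' = X" if sX: "primal_solution A b C X'" for X'
  proof (rule ccontr)
    assume "X' \<noteq> X"
    then obtain W where "primal_feasible A b W" "W \<bullet> (C - constraint_adjoint A y) = 0"
      "rank (mat_of W) + rank (mat_of (C - constraint_adjoint A y)) < CARD('n)"
      using nonunique_imp_degenerate[OF y0 _ kkt[OF sX dy] X(1) kkt[OF pX dy] _ psdZ] sX
      by (auto simp: sol_p)
    then show False using C y(1) unfolding degenerate_costs_def by blast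
  qed
  moreover have "y' = y" if y': "dual_solution A b C y'" for y'
  proof -
    have "psd (C - constraint_adjoint A y')" using y' by (simp add: sol_d dual_feasible_def)
    then have "mat_of (C - constraint_adjoint A y') *v (mat_of X *v v) = 0" for v
      by (intro psd_inner_zero psdX kkt pX y')
    moreover have "mat_of (C - constraint_adjoint A y) *v (mat_of X *v v) = 0" for v
      by (intro psd_inner_zero psdX psdZ kkt pX dy)
    ultimately have "mat_of (constraint_adjoint A (y' - y)) *v (mat_of X *v v) = 0" for v
      by (simp add: linear_diff[OF linear_constraint_adjoint] matrix_vector_mult_diff_rdistrib)
    then have "y' - y = 0" using X(1) using indep[of X "y' - y"] by (simp only: primal_feasible_def)
    then show ?thesis by simp
  qed
  ultimately show ?thesis unfolding simple_sdp_def using surj pX dy by blast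
qed

section \<open>Degenerate costs are negligible for almost every right-hand side\<close>

lemma negligible_iff_AE:
  fixes S :: "'a::euclidean_space set"
  shows "negligible S \<longleftrightarrow> (AE x in lborel. x \<notin> S)"
proof
  assume "negligible S"
  then have "AE x in lebesgue. x \<notin> S"
    by (simp add: negligible_iff_null_sets AE_not_in)
  then show "AE x in lborel. x \<notin> S" by (simp add: AE_completion_iff)
next
  assume "AE x in lborel. x \<notin> S"
  then have "AE x in lebesgue. x \<notin> S" by (simp add: AE_completion_iff)
  then obtain N where "N \<in> null_sets lebesgue" "S \<subseteq> N"
    by (auto simp: eventually_ae_filter)
  then show "negligible S"
    using negligible_iff_null_sets negligible_subset by blast
qed

lemma det_eq_0_iff_rank:
  fixes M :: "real ^ 'n ^ 'n"
  shows "det M = 0 \<longleftrightarrow> rank M < CARD('n)"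
  using invertible_det_nz[of M] invertible_left_inverse[of M] matrix_left_invertible_injective[of M]
    less_rank_noninjective[of M] by blast

text \<open>These \<open>t\<close> are negated eigenvalues of \<open>M\<close>, and eigenvectors for different ones are orthogonal.\<close>

lemma finite_singular_shifts:
  fixes M :: "'n::finite symmat"
  shows "finite {t. det (mat_of (M + t *\<^sub>R ident)) = 0}" (is "finite ?T")
proof -
  have "\<exists>v. v \<noteq> 0 \<and> mat_of M *v v = - t *\<^sub>R v" if "t \<in> ?T" for t
  proof -
    obtain v where v: "v \<noteq> 0" "mat_of (M + t *\<^sub>R ident) *v v = 0"
      using \<open>t \<in> ?T\<close> matrix_nonfull_linear_equations_eq[of "mat_of (M + t *\<^sub>R ident)"]
      unfolding mem_Collect_eq det_eq_0_iff_rank by (metis less_irrefl)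
    have "mat_of M *v v + t *\<^sub>R v = 0"
      using v(2) by (simp add: matrix_vector_mult_add_rdistrib flip: scaleR_matrix_vector_assoc)
    then show ?thesis using v(1) by (intro exI[of _ v]) (simp add: eq_neg_iff_add_eq_0)
  qed
  then obtain v where v: "\<And>t. t \<in> ?T \<Longrightarrow> v t \<noteq> 0" "\<And>t. t \<in> ?T \<Longrightarrow> mat_of M *v v t = - t *\<^sub>R v t"
    by metis
  have orth: "v s \<bullet> v t = 0" if "s \<in> ?T" "t \<in> ?T" "s \<noteq> t" for s t
  proof -
    have "- s * (v s \<bullet> v t) = (mat_of M *v v s) \<bullet> v t" using v(2)[OF that(1)] by simp
    also have "\<dots> = v s \<bullet> (mat_of M *v v t)" by (rule inner_matrix_vector_left)
    also have "\<dots> = - t * (v s \<bullet> v t)" using v(2)[OF that(2)] by simp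
    finally show ?thesis using that(3) by simp
  qed
  have "finite (v ` ?T)"
    by (intro pairwise_orthogonal_imp_finite) (auto simp: pairwise_def orthogonal_def intro!: orth)
  moreover have "inj_on v ?T"
    by (intro inj_onI) (metis inner_eq_zero_iff orth v(1))
  ultimately show ?thesis by (rule finite_imageD)
qed

lemma linear_mat_of: "linear mat_of"
  by (rule linearI) simp_all

lemma continuous_on_det_symmat:
  fixes f :: "'a::topological_space \<Rightarrow> 'n::finite symmat"
  assumes "continuous_on S f"
  shows "continuous_on S (\<lambda>x. det (mat_of (f x)))"
proof -
  have "continuous_on S (\<lambda>x. mat_of (f x))"
    using linear_mat_of
    by (intro continuous_on_compose2[OF linear_continuous_on[of _ UNIV] assms])
      (simp_all add: linear_conv_bounded_linear)
  then show ?thesis unfolding det_def by (intro continuous_intros)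
qed

lemma closed_singular: "closed {M :: 'n::finite symmat. det (mat_of M) = 0}"
  by (intro closed_Collect_eq continuous_on_det_symmat continuous_intros)

text \<open>
  By Fubini's theorem, almost every translate of the set of singular matrices in the direction of
  the identity is a null set, since every line in that direction meets it in finitely many points.
\<close>

lemma negligible_singular: "negligible {M :: 'n::finite symmat. det (mat_of M) = 0}"
proof -
  let ?P = "\<lambda>(M :: 'n symmat) t. det (mat_of (M + t *\<^sub>R ident)) \<noteq> 0"
  have "AE M in lborel. AE t in lborel. ?P M t"
  proof (rule AE_I2)
    fix M :: "'n symmat"
    show "AE t in lborel. ?P M t"
      using negligible_finite[OF finite_singular_shifts[of M]] by (simp add: negligible_iff_AE)
  qed
  moreover have "{x \<in> space (lborel \<Otimes>\<^sub>M lborel). ?P (fst x) (snd x)} \<in> sets (lborel \<Otimes>\<^sub>M lborel)"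
  proof -
    have "open {x :: 'n symmat \<times> real. ?P (fst x) (snd x)}"
      by (intro open_Collect_neq continuous_on_det_symmat continuous_intros)
    then show ?thesis unfolding lborel_prod by simp
  qed
  ultimately have "AE t in lborel. AE M in lborel. ?P M t"
    by (simp add: lborel_pair.AE_commute)
  then have "negligible {t. \<not> (AE M in lborel. ?P M t)}"
    by (simp add: negligible_iff_AE)
  then have "{t. \<not> (AE M in lborel. ?P M t)} \<noteq> UNIV" by (metis non_negligible_UNIV)
  then obtain t where "AE M in lborel. ?P M t" by blast
  then have "negligible {M. \<not> ?P M t}" by (simp add: negligible_iff_AE)
  then have "negligible ((+) (t *\<^sub>R ident) ` {M. \<not> ?P M t})" by (rule negligible_translation)
  then show ?thesis
  proof (rule negligible_subset, intro subsetI, unfold mem_Collect_eq)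
    fix M :: "'n symmat"
    assume "det (mat_of M) = 0"
    then show "M \<in> (+) (t *\<^sub>R ident) ` {M. \<not> ?P M t}"
      by (intro image_eqI[of _ _ "M - t *\<^sub>R ident"]) simp_all
  qed
qed

text \<open>
  Two matrices of the cone with inner product 0 are the positive and negative parts of their
  difference; the positive part is the projection to the cone.
\<close>

lemma closest_psd_diff:
  assumes X: "psd X" and Z: "psd Z" and XZ: "X \<bullet> Z = 0"
  shows "closest_point {X. psd X} (X - Z) = X"
proof -
  have "dist (X - Z) X \<le> dist (X - Z) W" if "psd W" for W
  proof -
    have "(norm (X - Z - W))\<^sup>2 = (norm (X - W))\<^sup>2 + (norm Z)\<^sup>2 + 2 * (Z \<bullet> W)"
      using XZ by (simp add: power2_norm_eq_inner inner_diff_left inner_diff_right inner_commute algebra_simps)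
    moreover have "0 \<le> Z \<bullet> W" using Z that by (rule psd_inner_nonneg)
    ultimately have "(norm Z)\<^sup>2 \<le> (norm (X - Z - W))\<^sup>2" by simp
    then have "norm Z \<le> norm (X - Z - W)" by (rule power2_le_imp_le) simp
    then show ?thesis by (simp add: dist_norm)
  qed
  then show ?thesis
    using closest_point_unique[OF convex_psd closed_psd, of X "X - Z"] X by simp
qed

lemma AE_negligible_degenerate_costs:
  fixes A :: "'m::finite \<Rightarrow> 'n::finite symmat"
  shows "AE b in lborel. negligible (degenerate_costs A b)"
proof -
  \<comment> \<open>\<open>\<Phi> (y, X - Z) = (b, C)\<close> if \<open>(X, y)\<close> is feasible for \<open>(b, C)\<close> without gap, with slack \<open>Z\<close>.\<close>
  define p :: "'n symmat \<Rightarrow> 'n symmat" where "p = closest_point {X. psd X}"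
  define \<Phi> where "\<Phi> = (\<lambda>x :: (real ^ 'm) \<times> 'n symmat.
    (constraint_map A (p (snd x)), constraint_adjoint A (fst x) + p (snd x) - snd x))"
  define E where "E = (UNIV :: (real ^ 'm) set) \<times> {M :: 'n symmat. det (mat_of M) = 0}"
  have "negligible E"
  proof -
    let ?S = "{M :: 'n symmat. det (mat_of M) = 0}"
    have "?S \<in> null_sets lborel"
      using negligible_singular[where 'n = 'n] null_sets_completion_iff[of ?S lborel]
        borel_closed[OF closed_singular[where 'n = 'n]]
      by (simp add: negligible_iff_null_sets)
    then have "E \<in> null_sets (lborel \<Otimes>\<^sub>M lborel)"
      unfolding E_def by (intro lborel.times_in_null_sets2) simp_all
    then show ?thesis
      by (simp add: lborel_prod negligible_iff_null_sets null_sets_completionI)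
  qed
  obtain K where K: "\<And>X. norm (constraint_map A X) \<le> K * norm X"
    using linear_bounded[OF linear_constraint_map] by blast
  obtain L where L: "\<And>y. norm (constraint_adjoint A y) \<le> L * norm y"
    using linear_bounded[OF linear_constraint_adjoint] by blast
  have p: "norm (p M - p N) \<le> norm (M - N)" for M N
    using closest_point_lipschitz[OF convex_psd closed_psd, of M N] psd_zero
    by (auto simp: p_def dist_norm)
  have lip: "norm (\<Phi> x - \<Phi> x') \<le> (\<bar>K\<bar> + \<bar>L\<bar> + 2) * norm (x - x')" for x x'
  proof -
    obtain y M y' M' where x: "x = (y, M)" "x' = (y', M')" by (cases x, cases x')
    let ?d = "norm (x - x')"
    have M: "norm (M - M') \<le> ?d" and y: "norm (y - y') \<le> ?d"
      using norm_snd_le[of "M - M'" "y - y'"] norm_fst_le[of "y - y'" "M - M'"] by (simp_all add: x)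
    have "norm (\<Phi> x - \<Phi> x') \<le> norm (constraint_map A (p M - p M'))
        + norm (constraint_adjoint A (y - y') + (p M - p M') - (M - M'))"
      using norm_Pair_le[of "constraint_map A (p M - p M')"
          "constraint_adjoint A (y - y') + (p M - p M') - (M - M')"]
      by (simp add: \<Phi>_def x linear_diff[OF linear_constraint_map]
          linear_diff[OF linear_constraint_adjoint] algebra_simps)
    also have "norm (constraint_map A (p M - p M')) \<le> \<bar>K\<bar> * ?d"
      using K[of "p M - p M'"] p[of M M'] M
      by (smt (verit) mult_mono norm_ge_zero)
    also have "norm (constraint_adjoint A (y - y') + (p M - p M') - (M - M')) \<le> \<bar>L\<bar> * ?d + ?d + ?d"
    proof -
      have "norm (constraint_adjoint A (y - y')) \<le> \<bar>L\<bar> * ?d"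
        using L[of "y - y'"] y by (smt (verit) mult_mono norm_ge_zero)
      then show ?thesis
        using p[of M M'] M norm_triangle_ineq4[of "constraint_adjoint A (y - y') + (p M - p M')" "M - M'"]
          norm_triangle_ineq[of "constraint_adjoint A (y - y')" "p M - p M'"] by linarith
    qed
    finally show ?thesis by (simp add: algebra_simps)
  qed
  have "negligible (\<Phi> ` E)"
    using \<open>negligible E\<close>
    by (rule negligible_locally_Lipschitz_image[OF order_refl])
      (intro exI[of _ UNIV] exI[of _ "\<bar>K\<bar> + \<bar>L\<bar> + 2"], simp add: lip)
  then have "AE x in lborel \<Otimes>\<^sub>M lborel. x \<notin> \<Phi> ` E"
    by (simp only: negligible_iff_AE lborel_prod)
  then have "AE b in lborel. AE C in lborel. (b, C) \<notin> \<Phi> ` E"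
    by (rule lborel_pair.AE_pair)
  then show ?thesis
  proof (rule AE_mp, intro AE_I2 impI)
    fix b :: "real ^ 'm"
    assume "AE C in lborel. (b, C) \<notin> \<Phi> ` E"
    then have "negligible {C. (b, C) \<in> \<Phi> ` E}" by (simp add: negligible_iff_AE)
    moreover have "(b, C) \<in> \<Phi> ` E" if C: "C \<in> degenerate_costs A b" for C
    proof -
      obtain X y where X: "primal_feasible A b X" and y: "dual_feasible A C y"
        and XZ: "X \<bullet> (C - constraint_adjoint A y) = 0"
        and rank: "rank (mat_of X) + rank (mat_of (C - constraint_adjoint A y)) < CARD('n)"
        using C unfolding degenerate_costs_def by blast
      define Z where "Z = C - constraint_adjoint A y"
      have "rank (mat_of (X - Z)) < CARD('n)"
        using rank_diff_le[of "mat_of X" "mat_of Z"] rank by (simp add: Z_def)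
      then have "(y, X - Z) \<in> E"
        by (simp add: E_def det_eq_0_iff_rank)
      moreover have "p (X - Z) = X"
        unfolding p_def using X y XZ
        by (intro closest_psd_diff) (simp_all add: Z_def primal_feasible_def dual_feasible_def)
      then have "\<Phi> (y, X - Z) = (b, C)"
        using X by (simp add: \<Phi>_def primal_feasible_def Z_def)
      ultimately show ?thesis by (metis image_eqI)
    qed
    ultimately show "negligible (degenerate_costs A b)"
      using negligible_subset by blast
  qed
qed

section \<open>Congruences between right-hand sides\<close>

text \<open>The map \<open>X \<mapsto> D X D\<^sup>T\<close>.\<close>

definition congruence :: "real ^ 'n ^ 'n \<Rightarrow> 'n::finite symmat \<Rightarrow> 'n symmat" where
  "congruence D X = Abs_symmat (D ** mat_of X ** transpose D)"

lemma mat_of_congruence: "mat_of (congruence D X) = D ** mat_of X ** transpose D"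
  unfolding congruence_def
  by (rule Abs_symmat_inverse) (simp add: matrix_transpose_mul matrix_mul_assoc)

lemma matrix_matrix_add_rdistrib:
  fixes A B :: "real ^ 'n ^ 'm" and C :: "real ^ 'p ^ 'n"
  shows "(A + B) ** C = A ** C + B ** C"
  by (simp add: matrix_matrix_mult_def vec_eq_iff distrib_right sum.distrib)

lemma linear_congruence: "linear (congruence D)"
proof -
  have "mat_of (congruence D (r *\<^sub>R X)) = mat_of (r *\<^sub>R congruence D X)" for r X
    by (simp add: mat_of_congruence matrix_scalar_ac flip: scalar_matrix_assoc)
  then show ?thesis
    by (intro linearI)
      (simp_all add: mat_of_inject[symmetric] mat_of_congruence matrix_add_ldistrib matrix_matrix_add_rdistrib)
qed

lemma congruence_congruence: "congruence D (congruence E X) = congruence (D ** E) X"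
  by (simp add: mat_of_inject[symmetric] mat_of_congruence matrix_transpose_mul matrix_mul_assoc)

lemma congruence_mat_1: "congruence (mat 1) X = X"
  by (simp add: mat_of_inject[symmetric] mat_of_congruence)

lemma psd_congruence:
  assumes "psd X" shows "psd (congruence D X)"
  unfolding psd_def
proof
  fix v
  have "v \<bullet> (mat_of (congruence D X) *v v) = v \<bullet> (D *v (mat_of X *v (transpose D *v v)))"
    by (simp only: mat_of_congruence matrix_vector_mul_assoc matrix_mul_assoc)
  also have "\<dots> = (transpose D *v v) \<bullet> (mat_of X *v (transpose D *v v))"
    by (simp add: dot_lmul_matrix)
  finally show "0 \<le> v \<bullet> (mat_of (congruence D X) *v v)" using assms by (simp add: psd_def)
qed

lemma inner_congruence: "congruence D X \<bullet> Y = X \<bullet> congruence (transpose D) Y"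
proof -
  have "congruence D X \<bullet> Y = trace (D ** (mat_of X ** transpose D ** mat_of Y))"
    by (simp add: objective_eq_trace mat_of_congruence matrix_mul_assoc)
  also have "\<dots> = trace (mat_of X ** transpose D ** mat_of Y ** D)"
    by (rule trace_mul_sym)
  also have "\<dots> = X \<bullet> congruence (transpose D) Y"
    by (simp add: objective_eq_trace mat_of_congruence matrix_mul_assoc)
  finally show ?thesis .
qed

lemma rank_congruence_le: "rank (mat_of (congruence D X)) \<le> rank (mat_of X)"
  unfolding mat_of_congruence by (meson order_trans rank_mul_le_left rank_mul_le_right)

text \<open>
  If \<open>X\<close> is transformed by \<open>D\<close>, then slack matrices, costs and the range of \<open>A\<^sup>*\<close> are
  transformed by the inverse transpose of \<open>D\<close>.
\<close>

lemma degenerate_costs_congruence: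
  fixes A :: "'m::finite \<Rightarrow> 'n::finite symmat"
  assumes ED: "E ** D = mat 1"
    and primal: "\<And>X. constraint_map A X = b \<Longrightarrow> constraint_map A (congruence D X) = b'"
    and dual: "\<And>y. \<exists>y'. congruence (transpose E) (constraint_adjoint A y) = constraint_adjoint A y'"
    and C: "C \<in> degenerate_costs A b"
  shows "congruence (transpose E) C \<in> degenerate_costs A b'"
proof -
  obtain X y where X: "primal_feasible A b X" and y: "dual_feasible A C y"
    and XZ: "X \<bullet> (C - constraint_adjoint A y) = 0"
    and rank: "rank (mat_of X) + rank (mat_of (C - constraint_adjoint A y)) < CARD('n)"
    using C unfolding degenerate_costs_def by blast
  obtain y' where y': "congruence (transpose E) (constraint_adjoint A y) = constraint_adjoint A y'"
    using dual by blast
  define Z where "Z = C - constraint_adjoint A y"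
  define X' where "X' = congruence D X"
  have Z': "congruence (transpose E) C - constraint_adjoint A y' = congruence (transpose E) Z"
    by (simp add: Z_def y' linear_diff[OF linear_congruence])
  have "transpose D ** transpose E = mat 1"
    using ED by (metis matrix_transpose_mul transpose_mat)
  then have "X' \<bullet> congruence (transpose E) Z = X \<bullet> Z"
    by (simp add: X'_def inner_congruence congruence_congruence congruence_mat_1)
  then have "X' \<bullet> congruence (transpose E) Z = 0" using XZ by (simp add: Z_def)
  moreover have "primal_feasible A b' X'"
    using X primal by (simp add: primal_feasible_def X'_def psd_congruence)
  moreover have "dual_feasible A (congruence (transpose E) C) y'"
    using y by (simp add: dual_feasible_def Z' psd_congruence flip: Z_def)
  moreover have "rank (mat_of X') + rank (mat_of (congruence (transpose E) Z)) < CARD('n)"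
    using rank rank_congruence_le[of D X] rank_congruence_le[of "transpose E" Z]
    by (simp add: X'_def Z_def)
  ultimately show ?thesis
    unfolding degenerate_costs_def mem_Collect_eq by (intro exI[of _ X'] exI[of _ y']) (simp only: Z')
qed

text \<open>
  The nonempty open set \<open>U\<close> contains some \<open>b'\<close> whose degenerate costs form a null set, and the
  congruence carries this back to \<open>b\<close>.
\<close>

lemma negligible_degenerate_costs:
  fixes A :: "'m::finite \<Rightarrow> 'n::finite symmat"
  assumes U: "open U" "U \<noteq> {}"
    and cong: "\<And>b'. b' \<in> U \<Longrightarrow> \<exists>D E. E ** D = mat 1 \<and>
      (\<forall>X. constraint_map A X = b \<longrightarrow> constraint_map A (congruence D X) = b') \<and>
      (\<forall>y. \<exists>y'. congruence (transpose E) (constraint_adjoint A y) = constraint_adjoint A y')"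
  shows "negligible (degenerate_costs A b)"
proof -
  have "negligible {b'. \<not> negligible (degenerate_costs A b')}"
    using AE_negligible_degenerate_costs[of A] by (simp add: negligible_iff_AE)
  then have "\<not> U \<subseteq> {b'. \<not> negligible (degenerate_costs A b')}"
    using open_not_negligible[OF U] negligible_subset by blast
  then obtain b' where b': "b' \<in> U" "negligible (degenerate_costs A b')" by blast
  obtain D E where DE: "E ** D = mat 1"
      "\<And>X. constraint_map A X = b \<Longrightarrow> constraint_map A (congruence D X) = b'"
      "\<And>y. \<exists>y'. congruence (transpose E) (constraint_adjoint A y) = constraint_adjoint A y'"
    using cong[OF b'(1)] by blast
  have "negligible (congruence (transpose D) ` degenerate_costs A b')"
    using b'(2)
    by (intro negligible_differentiable_image_negligible linear_imp_differentiable_on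
        linear_congruence) simp_all
  moreover have "C \<in> congruence (transpose D) ` degenerate_costs A b'"
    if "C \<in> degenerate_costs A b" for C
  proof -
    have "transpose D ** transpose E = mat 1"
      using DE(1) by (metis matrix_transpose_mul transpose_mat)
    then have "C = congruence (transpose D) (congruence (transpose E) C)"
      by (simp add: congruence_congruence congruence_mat_1)
    then show ?thesis using degenerate_costs_congruence[OF DE that] by blast
  qed
  ultimately show ?thesis using negligible_subset by blast
qed

lemma AE_simple_sdp:
  fixes A :: "'m::finite \<Rightarrow> 'n::finite symmat"
  assumes "constraint_adjoint A y0 = ident"
    and "constraint_map A W = b" "\<And>v. v \<noteq> 0 \<Longrightarrow> 0 < v \<bullet> (mat_of W *v v)"
    and "\<And>X u. constraint_map A X = b \<Longrightarrow>
      (\<And>v. mat_of (constraint_adjoint A u) *v (mat_of X *v v) = 0) \<Longrightarrow> u = 0"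
    and "open U" "U \<noteq> {}"
    and "\<And>b'. b' \<in> U \<Longrightarrow> \<exists>D E. E ** D = mat 1 \<and>
      (\<forall>X. constraint_map A X = b \<longrightarrow> constraint_map A (congruence D X) = b') \<and>
      (\<forall>y. \<exists>y'. congruence (transpose E) (constraint_adjoint A y) = constraint_adjoint A y')"
  shows "AE C in lebesgue. simple_sdp A b C"
proof -
  have "negligible (degenerate_costs A b)"
    using assms(5-7) by (rule negligible_degenerate_costs)
  then have "AE C in lebesgue. C \<notin> degenerate_costs A b"
    by (simp add: negligible_iff_null_sets AE_not_in)
  then show ?thesis
    by (rule AE_mp) (intro AE_I2 impI simple_sdp_if_not_degenerate[OF assms(1-4)])
qed

section \<open>ProductSDP and MaxCut\<close>

text \<open>The diagonal matrix with entries \<open>d\<close>.\<close>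

definition diagonal :: "('n \<Rightarrow> real) \<Rightarrow> real ^ 'n ^ 'n" where
  "diagonal d = (\<chi> k l. if k = l then d k else 0)"

lemma transpose_diagonal [simp]: "transpose (diagonal d) = diagonal d"
  by (simp add: transpose_def diagonal_def vec_eq_iff)

lemma diagonal_matrix_mult: "(diagonal d ** M) $ k $ l = d k * M $ k $ l"
  by (simp add: matrix_matrix_mult_def diagonal_def if_distrib[of "\<lambda>x. x * _"] cong: if_cong)

lemma matrix_mult_diagonal: "(M ** diagonal d) $ k $ l = M $ k $ l * d l"
  by (simp add: matrix_matrix_mult_def diagonal_def if_distrib[of "\<lambda>x. _ * x"] cong: if_cong)

lemma diagonal_vector_mult: "(diagonal d *v v) $ k = d k * v $ k"
  by (simp add: matrix_vector_mult_def diagonal_def if_distrib[of "\<lambda>x. x * _"] cong: if_cong)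

lemma mat_of_constraint_adjoint:
  "mat_of (constraint_adjoint A y) $ k $ l = (\<Sum>i\<in>UNIV. y $ i * mat_of (A i) $ k $ l)"
proof -
  have "linear (\<lambda>X. mat_of X $ k $ l)" by (rule linearI) simp_all
  from linear_sum[OF this, of "\<lambda>i. y $ i *\<^sub>R A i" UNIV] show ?thesis
    by (simp add: constraint_adjoint_def)
qed

lemma AE_simple_sdp_product:
  fixes P :: "'m::finite \<Rightarrow> 'D::finite set"
  assumes ne: "\<And>i. P i \<noteq> {}" and disj: "disjoint_family P" and cover: "(\<Union>i. P i) = UNIV"
  shows "AE C :: 'D symmat in lebesgue. simple_sdp (product_A P) product_b C"
proof -
  have "\<forall>k. \<exists>i. k \<in> P i" using cover by blast
  \<comment> \<open>\<open>c k\<close> is the index of the class of \<open>k\<close>.\<close>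
  then obtain c where "\<And>k. k \<in> P (c k)" by metis
  then have c: "k \<in> P i \<longleftrightarrow> i = c k" for k i
    using disj by (auto simp: disjoint_family_on_def)
  let ?adj = "constraint_adjoint (product_A P)"
  have adj: "mat_of (?adj y) = diagonal (\<lambda>k. y $ c k)" for y
    by (simp add: vec_eq_iff mat_of_constraint_adjoint mat_of_product_A diagonal_def c
        of_bool_def if_distrib[of "\<lambda>x. _ * x"] cong: if_cong)
  have map: "constraint_map (product_A P) X $ i = (\<Sum>k\<in>P i. mat_of X $ k $ k)" for X i
    by (simp add: constraint_map_def inner_product_A)
  define y1 :: "real ^ 'm" where "y1 = (\<chi> i. 1 / real (card (P i)))"
  have card: "card (P i) > 0" for i using ne[of i] by (simp add: card_gt_0_iff)
  show ?thesis
  proof (rule AE_simple_sdp[where W = "?adj y1" and U = "{b. \<forall>i. 0 < b $ i}"])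
    show "?adj (\<chi> i. 1) = ident"
      by (simp add: symmat_eq_iff adj diagonal_def mat_def)
    show "constraint_map (product_A P) (?adj y1) = product_b"
    proof (unfold vec_eq_iff, intro allI)
      fix i
      have "(\<Sum>k\<in>P i. y1 $ c k) = (\<Sum>k\<in>P i. 1 / real (card (P i)))"
        by (intro sum.cong) (auto simp: c y1_def)
      then show "constraint_map (product_A P) (?adj y1) $ i = product_b $ i"
        using ne[of i] by (simp add: map adj diagonal_def product_b_def)
    qed
    show "0 < v \<bullet> (mat_of (?adj y1) *v v)" if "v \<noteq> 0" for v
    proof -
      obtain k where k: "v $ k \<noteq> 0" using \<open>v \<noteq> 0\<close> by (metis vec_eq_iff zero_index)
      have eq: "v \<bullet> (mat_of (?adj y1) *v v) = (\<Sum>k\<in>UNIV. (v $ k)\<^sup>2 / real (card (P (c k))))"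
        by (simp add: inner_vec_def adj diagonal_vector_mult y1_def power2_eq_square)
      show ?thesis
        unfolding eq using k card by (intro sum_pos2[of _ k]) simp_all
    qed
    show "u = 0" if X: "constraint_map (product_A P) X = product_b"
      and u: "\<And>v. mat_of (?adj u) *v (mat_of X *v v) = 0" for X u
    proof (unfold vec_eq_iff, intro allI)
      fix i
      have uX: "u $ c k * mat_of X $ k $ k = 0" for k
        using u[of "axis k 1"] by (metis adj diagonal_vector_mult matrix_vector_axis_nth zero_index)
      have "u $ i = u $ i * constraint_map (product_A P) X $ i" by (simp add: X product_b_def)
      also have "\<dots> = (\<Sum>k\<in>P i. u $ c k * mat_of X $ k $ k)"
        unfolding map sum_distrib_left by (intro sum.cong) (auto simp: c)
      finally show "u $ i = 0 $ i" by (simp add: uX)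
    qed
    show "open {b :: real ^ 'm. \<forall>i. 0 < b $ i}"
      unfolding Collect_all_eq by (intro open_INT ballI open_Collect_less continuous_intros) simp
    have "(\<chi> i. 1) \<in> {b :: real ^ 'm. \<forall>i. 0 < b $ i}" by simp
    then show "{b :: real ^ 'm. \<forall>i. 0 < b $ i} \<noteq> {}" by blast
  next
    fix b :: "real ^ 'm"
    assume "b \<in> {b. \<forall>i. 0 < b $ i}"
    then have b: "b $ i > 0" for i by simp
    then have b0: "b $ i \<noteq> 0" for i by (metis less_irrefl)
    let ?D = "diagonal (\<lambda>k. sqrt (b $ c k))" and ?E = "diagonal (\<lambda>k. 1 / sqrt (b $ c k))"
    have "?E ** ?D = mat 1"
      by (simp add: vec_eq_iff diagonal_matrix_mult) (simp add: diagonal_def mat_def b0)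
    moreover have "constraint_map (product_A P) (congruence ?D X) = b"
      if X: "constraint_map (product_A P) X = product_b" for X
    proof (unfold vec_eq_iff, intro allI)
      fix i
      have "constraint_map (product_A P) (congruence ?D X) $ i = (\<Sum>k\<in>P i. b $ i * mat_of X $ k $ k)"
        unfolding map using b
        by (intro sum.cong) (auto simp: c mat_of_congruence diagonal_matrix_mult matrix_mult_diagonal less_imp_le)
      also have "\<dots> = b $ i * constraint_map (product_A P) X $ i"
        by (simp add: map sum_distrib_left)
      finally show "constraint_map (product_A P) (congruence ?D X) $ i = b $ i"
        by (simp add: X product_b_def)
    qed
    moreover have "congruence (transpose ?E) (?adj y) = ?adj (\<chi> i. y $ i / b $ i)" for y
      using b by (simp add: symmat_eq_iff mat_of_congruence diagonal_matrix_mult matrix_mult_diagonal adj)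
        (simp add: diagonal_def less_imp_le)
    ultimately show "\<exists>D E. E ** D = mat 1 \<and>
      (\<forall>X. constraint_map (product_A P) X = product_b \<longrightarrow>
        constraint_map (product_A P) (congruence D X) = b) \<and>
      (\<forall>y. \<exists>y'. congruence (transpose E) (?adj y) = ?adj y')"
      by blast
  qed
qed

lemma AE_simple_sdp_maxcut:
  "AE C :: 'n::finite symmat in lebesgue. simple_sdp maxcut_A maxcut_b C"
proof -
  have A: "(maxcut_A :: 'n \<Rightarrow> _) = product_A (\<lambda>i. {i})"
    by (rule ext) (auto simp: symmat_eq_iff mat_of_maxcut_A mat_of_product_A)
  have b: "(maxcut_b :: real ^ 'n) = product_b" by (simp add: maxcut_b_def product_b_def)
  show ?thesis
    unfolding A b by (rule AE_simple_sdp_product) (auto simp: disjoint_family_on_def)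
qed

section \<open>OrthogonalCut\<close>

text \<open>The block diagonal matrix with diagonal blocks \<open>V s\<close>.\<close>

definition block_diagonal ::
  "('s \<Rightarrow> real ^ 'd ^ 'd) \<Rightarrow> real ^ ('s::finite \<times> 'd::finite) ^ ('s \<times> 'd)" where
  "block_diagonal V = (\<chi> k l. if fst k = fst l then V (fst k) $ snd k $ snd l else 0)"

lemma block_diagonal_nth:
  "block_diagonal V $ (s, i) $ (t, j) = (if s = t then V s $ i $ j else 0)"
  by (simp add: block_diagonal_def)

lemma sum_block:
  fixes f :: "'s::finite \<times> 'd::finite \<Rightarrow> real"
  shows "(\<Sum>l\<in>UNIV. if s = fst l then f l else 0) = (\<Sum>j\<in>UNIV. f (s, j))"
proof -
  have "(\<Sum>l\<in>UNIV. if s = fst l then f l else 0)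
      = (\<Sum>t\<in>UNIV. \<Sum>j\<in>UNIV. if s = t then f (t, j) else 0)"
    by (simp add: sum.cartesian_product case_prod_unfold cong: if_cong flip: UNIV_Times_UNIV)
  also have "\<dots> = (\<Sum>t\<in>UNIV. if s = t then (\<Sum>j\<in>UNIV. f (t, j)) else 0)"
    by (intro sum.cong) auto
  finally show ?thesis by simp
qed

lemma block_diagonal_mult_nth:
  "(block_diagonal V ** M) $ (s, i) $ l = (\<Sum>j\<in>UNIV. V s $ i $ j * M $ (s, j) $ l)"
  using sum_block[of s "\<lambda>k. V s $ i $ snd k * M $ k $ l"]
  by (simp add: matrix_matrix_mult_def block_diagonal_def if_distrib[of "\<lambda>x. x * _"] cong: if_cong)

lemma mult_transpose_block_diagonal_nth:
  "(M ** transpose (block_diagonal V)) $ k $ (s, j) = (\<Sum>i\<in>UNIV. M $ k $ (s, i) * V s $ j $ i)"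
  using sum_block[of s "\<lambda>l. M $ k $ l * V s $ j $ snd l"]
  by (simp add: matrix_matrix_mult_def transpose_def block_diagonal_def if_distrib[of "\<lambda>x. _ * x"]
      cong: if_cong)

lemma block_diagonal_mult: "block_diagonal V ** block_diagonal W = block_diagonal (\<lambda>s. V s ** W s)"
  by (simp add: vec_eq_iff block_diagonal_mult_nth split_paired_all)
    (auto simp: block_diagonal_nth matrix_matrix_mult_def)

lemma transpose_block_diagonal:
  "transpose (block_diagonal V) = block_diagonal (\<lambda>s. transpose (V s))"
  by (simp add: transpose_def block_diagonal_def vec_eq_iff)

lemma block_diagonal_mat_1: "block_diagonal (\<lambda>s. mat 1) = mat 1"
  by (simp add: mat_def block_diagonal_def vec_eq_iff)

lemma Block_congruence_block_diagonal:
  "Block s (congruence (block_diagonal V) X) = V s ** Block s X ** transpose (V s)"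
  by (simp add: vec_eq_iff Block_def mat_of_congruence mult_transpose_block_diagonal_nth
      block_diagonal_mult_nth) (simp add: matrix_matrix_mult_def transpose_def)

lemma mat_of_orthcut_adjoint:
  fixes y :: "real ^ ('s::finite \<times> 'd::finite uprod)"
  shows "mat_of (constraint_adjoint orthcut_A y)
    = block_diagonal (\<lambda>s. \<chi> i j. y $ (s, Upair i j) / real (card {i, j}))"
proof -
  have "mat_of (constraint_adjoint orthcut_A y) $ (s, i) $ (t, j)
      = (if s = t then y $ (s, Upair i j) / real (card {i, j}) else 0)" for s t i j
  proof -
    have "mat_of (constraint_adjoint orthcut_A y) $ (s, i) $ (t, j)
      = (\<Sum>q\<in>UNIV. if q = (s, Upair i j) then (if s = t then y $ (s, Upair i j) / real (card {i, j}) else 0) else 0)"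
      unfolding mat_of_constraint_adjoint
    proof (intro sum.cong refl)
      fix q :: "'s \<times> 'd uprod"
      obtain r p where q: "q = (r, p)" by (cases q)
      show "y $ q * mat_of (orthcut_A q) $ (s, i) $ (t, j) = (if q = (s, Upair i j)
          then (if s = t then y $ (s, Upair i j) / real (card {i, j}) else 0) else 0)"
        unfolding q mat_of_orthcut_A by auto
    qed
    then show ?thesis by simp
  qed
  then show ?thesis by (simp add: vec_eq_iff split_paired_all block_diagonal_nth)
qed

text \<open>
  The range of \<open>A\<^sup>*\<close> consists of the symmetric block diagonal matrices.  The cardinality cancels the divisor
  in \<^const>\<open>orthcut_A\<close>.
\<close>

lemma block_diagonal_in_range_adjoint:
  assumes "mat_of W = block_diagonal V"
  shows "constraint_adjoint orthcut_A
    (\<chi> q. real (card (set_uprod (snd q))) * (orthcut_A q \<bullet> W)) = W"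
  unfolding mat_of_inject[symmetric] mat_of_orthcut_adjoint assms
  by (simp add: vec_eq_iff split_paired_all block_diagonal_nth inner_orthcut_A Block_def assms)

lemma constraint_map_orthcut_iff:
  fixes X :: "('s::finite \<times> 'd::finite) symmat"
  shows "constraint_map orthcut_A X = b \<longleftrightarrow> (\<forall>s i j. Block s X $ i $ j = b $ (s, Upair i j))"
proof
  assume *: "\<forall>s i j. Block s X $ i $ j = b $ (s, Upair i j)"
  have "orthcut_A (s, p) \<bullet> X = b $ (s, p)" for s p
    by (cases p) (simp add: inner_orthcut_A *)
  then show "constraint_map orthcut_A X = b" by (simp add: constraint_map_def vec_eq_iff)
qed (auto simp: constraint_map_def inner_orthcut_A)

lemma constraint_map_orthcut_b_iff:
  fixes X :: "('s::finite \<times> 'd::finite) symmat"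
  shows "constraint_map orthcut_A X = orthcut_b \<longleftrightarrow> (\<forall>s. Block s X = mat 1)"
  unfolding constraint_map_orthcut_iff by (simp add: orthcut_b_def vec_eq_iff mat_def of_bool_def)

lemma posdef_factorization:
  fixes B :: "'d::finite symmat"
  assumes pos: "\<And>v. v \<noteq> 0 \<Longrightarrow> 0 < v \<bullet> (mat_of B *v v)"
  shows "\<exists>V F :: real ^ 'd ^ 'd. mat_of B = V ** transpose V \<and> F ** V = mat 1"
proof -
  have "0 \<le> v \<bullet> (mat_of B *v v)" for v using pos[of v] by (cases "v = 0") auto
  then have "psd B" by (simp add: psd_def)
  then obtain u :: "'d \<Rightarrow> real ^ 'd" where u: "B = (\<Sum>k\<in>UNIV. outer (u k))"
    by (rule psd_imp_sum_outer)
  define V :: "real ^ 'd ^ 'd" where "V = (\<chi> i k. u k $ i)"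
  have V: "mat_of B = V ** transpose V"
    unfolding u linear_sum[OF linear_mat_of]
    by (simp add: vec_eq_iff mat_of_outer V_def matrix_matrix_mult_def transpose_def)
  have "inj ((*v) (transpose V))"
    unfolding linear_injective_0[OF matrix_vector_mul_linear]
  proof (intro allI impI)
    fix v assume "transpose V *v v = 0"
    then have "mat_of B *v v = 0" by (simp add: V flip: matrix_vector_mul_assoc)
    then show "v = 0" using pos[of v] by auto
  qed
  then obtain G where "G ** transpose V = mat 1"
    by (metis matrix_left_invertible_injective)
  then have "transpose G ** V = mat 1"
    by (metis matrix_left_right_inverse matrix_transpose_mul transpose_mat transpose_transpose)
  then show ?thesis using V by blast
qed

text \<open>
  Right-hand sides \<open>b\<close> correspond to families \<open>B b s\<close> of symmetric blocks.  If these are close to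
  the identity, they factor as \<open>V s (V s)\<^sup>T\<close>, and the congruence by the block diagonal matrix of
  the \<open>V s\<close> turns the constraint \<open>Block s X = 1\<close> into \<open>Block s X = B b s\<close>.
\<close>

lemma AE_simple_sdp_orthcut:
  "AE C :: ('s::finite \<times> 'd::finite) symmat in lebesgue. simple_sdp orthcut_A orthcut_b C"
proof -
  let ?adj = "constraint_adjoint (orthcut_A :: 's \<times> 'd uprod \<Rightarrow> _)"
  define B :: "real ^ ('s \<times> 'd uprod) \<Rightarrow> 's \<Rightarrow> 'd symmat"
    where "B b s = Abs_symmat (\<chi> i j. b $ (s, Upair i j))" for b s
  have mat_of_B: "mat_of (B b s) = (\<chi> i j. b $ (s, Upair i j))" for b s
  proof -
    have "Upair i j = Upair j i" for i j :: 'd by simp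
    then show ?thesis unfolding B_def by (intro mat_of_Abs_symmat_lambda) metis
  qed
  define U where "U = {b. \<forall>s. norm (B b s - ident) < 1 / 2}"
  have ident_range: "mat_of (ident :: ('s \<times> 'd) symmat) = block_diagonal (\<lambda>s. mat 1)"
    by (simp add: block_diagonal_mat_1)
  show ?thesis
  proof (rule AE_simple_sdp[where W = ident and U = U])
    show "?adj (\<chi> q. real (card (set_uprod (snd q))) * (orthcut_A q \<bullet> ident)) = ident"
      using ident_range by (rule block_diagonal_in_range_adjoint)
    show "constraint_map orthcut_A ident = (orthcut_b :: real ^ ('s \<times> 'd uprod))"
      unfolding constraint_map_orthcut_b_iff by (simp add: Block_def mat_def vec_eq_iff)
    show "0 < v \<bullet> (mat_of ident *v v)" if "v \<noteq> 0" for v :: "real ^ ('s \<times> 'd)"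
      using that by simp
    show "u = 0" if X: "constraint_map orthcut_A X = orthcut_b"
      and u: "\<And>v. mat_of (?adj u) *v (mat_of X *v v) = 0" for X u
    proof -
      have "u $ (s, Upair i j) = 0" for s i j
      proof -
        have "0 = (mat_of (?adj u) *v (mat_of X *v axis (s, j) 1)) $ (s, i)" by (simp add: u)
        also have "\<dots> = (mat_of (?adj u) ** mat_of X) $ (s, i) $ (s, j)"
          unfolding matrix_vector_mul_assoc by (simp add: matrix_vector_mul_component inner_axis)
        also have "\<dots> = (\<Sum>k\<in>UNIV. u $ (s, Upair i k) / real (card {i, k}) * Block s X $ k $ j)"
          by (simp add: mat_of_orthcut_adjoint block_diagonal_mult_nth Block_def)
        also have "\<dots> = u $ (s, Upair i j) / real (card {i, j})"
          using X by (simp add: constraint_map_orthcut_b_iff mat_def if_distrib[of "\<lambda>x. _ * x"] cong: if_cong)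
        finally show ?thesis by (simp add: card_gt_0_iff)
      qed
      then have "u $ (s, p) = 0" for s p by (cases p) simp
      then show ?thesis by (simp add: vec_eq_iff)
    qed
    have "linear (\<lambda>b. B b s)" for s
      by (rule linearI) (simp_all add: symmat_eq_iff mat_of_B)
    then have "continuous_on UNIV (\<lambda>b. B b s)" for s
      by (simp add: linear_continuous_on linear_conv_bounded_linear)
    then show "open U"
      unfolding U_def Collect_all_eq
      by (intro open_INT ballI open_Collect_less continuous_intros) simp_all
    have "B orthcut_b s = ident" for s
      by (simp add: symmat_eq_iff mat_of_B orthcut_b_def mat_def of_bool_def)
    then have "orthcut_b \<in> U" by (simp add: U_def)
    then show "U \<noteq> {}" by blast
  next
    fix b
    assume "b \<in> U"
    have pos: "0 < v \<bullet> (mat_of (B b s) *v v)" if "v \<noteq> 0" for v s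
    proof -
      have "psd ((1 / 2) *\<^sub>R ident + (B b s - ident))"
        using \<open>b \<in> U\<close> by (intro psd_shift_ident) (simp add: U_def less_imp_le)
      then have "0 \<le> ((1 / 2) *\<^sub>R ident + (B b s - ident)) \<bullet> outer v" unfolding psd_iff_outer by blast
      also have "\<dots> = B b s \<bullet> outer v - (v \<bullet> v) / 2"
        unfolding inner_add_left inner_diff_left inner_scaleR_left inner_ident_outer by simp
      finally show ?thesis using that by (simp add: inner_outer) (smt (verit) inner_gt_zero_iff half_gt_zero)
    qed
    have "\<exists>V F :: real ^ 'd ^ 'd. mat_of (B b s) = V ** transpose V \<and> F ** V = mat 1" for s
      by (intro posdef_factorization pos)
    then obtain V F :: "'s \<Rightarrow> real ^ 'd ^ 'd" where V: "\<And>s. mat_of (B b s) = V s ** transpose (V s)"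
      and F: "\<And>s. F s ** V s = mat 1" by metis
    have "block_diagonal F ** block_diagonal V = mat 1"
      by (simp add: block_diagonal_mult F block_diagonal_mat_1)
    moreover have "constraint_map orthcut_A (congruence (block_diagonal V) X) = b"
      if "constraint_map orthcut_A X = orthcut_b" for X
    proof -
      have "Block s (congruence (block_diagonal V) X) = mat_of (B b s)" for s
        using that by (simp add: constraint_map_orthcut_b_iff Block_congruence_block_diagonal V)
      then show ?thesis by (simp add: constraint_map_orthcut_iff mat_of_B)
    qed
    moreover have "\<exists>y'. congruence (transpose (block_diagonal F)) (?adj y) = ?adj y'" for y
    proof -
      have "mat_of (congruence (transpose (block_diagonal F)) (?adj y)) = block_diagonal
          (\<lambda>s. transpose (F s) ** (\<chi> i j. y $ (s, Upair i j) / real (card {i, j})) ** F s)"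
        by (simp add: mat_of_congruence transpose_block_diagonal mat_of_orthcut_adjoint block_diagonal_mult)
      from block_diagonal_in_range_adjoint[OF this, symmetric] show ?thesis by (rule exI)
    qed
    ultimately show "\<exists>D E. E ** D = mat 1 \<and>
      (\<forall>X. constraint_map orthcut_A X = orthcut_b \<longrightarrow>
        constraint_map orthcut_A (congruence D X) = b) \<and>
      (\<forall>y. \<exists>y'. congruence (transpose E) (?adj y) = ?adj y')"
      by blast
  qed
qed

section \<open>Generic simplicity\<close>

theorem corollary1:
  fixes P :: "'m::finite \<Rightarrow> 'D::finite set"
  shows
    "(AE C :: 'n::finite symmat in lebesgue. simple_sdp maxcut_A maxcut_b C) \<and>
     (CARD('d::finite) \<in> {1, 2, 3} \<longrightarrow>
       (AE C :: ('s::finite \<times> 'd) symmat in lebesgue. simple_sdp orthcut_A orthcut_b C)) \<and>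
     ((\<forall>i. P i \<noteq> {}) \<and> disjoint_family P \<and> (\<Union>i. P i) = UNIV \<longrightarrow>
       (AE C :: 'D symmat in lebesgue. simple_sdp (product_A P) product_b C))"
  by (intro conjI impI AE_simple_sdp_maxcut AE_simple_sdp_orthcut AE_simple_sdp_product) auto

end
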